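(* Consider $$u_t=\frac1{m+1}(u^{m+1})_{xx}+u^p(1-u)(u-a)$$ with $m=3/4$, $p=1/4$, $a=0.3$. Then for every $c\in[0.0999,0.1001]$ there is a finite value $\xi_{\min}$ such that the function $u(t,x)=\phi(x-ct)$ given by $$\phi(\xi)=\begin{cases}\varphi(\xi)&\xi>\xi_{\min},\\0&\xi\le\xi_{\min}\end{cases}$$ is a finite traveling wave solution with speed $c$ such that $\lim_{\xi\to+\infty}\phi(\xi)=a$ holds with oscillation. Here $\varphi$, re-expressed in the desingularized frame variable $z$, is the first component of an orbit of $$\dot\phi=\psi,\qquad\dot\psi=-c\psi-\phi(1-\phi)(\phi-a)$$ connecting $(0,0)$ (as $z\to-\infty$) to $(a,0)$ (as $z\to+\infty$).
   Context: Weak solution of $u_t=d(u^{m+1})_{xx}+f(u)$, $d=1/(m+1)$, with initial datum $u_0\in C^0(\mathbb{R})$, $0\le u_0\le1$: a nonnegative $u$ such that for each $r,T>0$, with $Q_T=(0,T)\times\mathbb{R}$, $u\in C(Q_T)\cap L^\infty(Q_T)$ and $$\int_0^T\!\!\int_{-r}^r\{u\phi_t+d\,u^{m+1}\phi_{xx}+f(u)\phi\}dxdt=\int_{-r}^r\{u(T,x)\phi(T,x)-u_0(x)\phi(0,x)\}dx+d\int_0^T\{u^{m+1}(t,r)\phi_x(t,r)-u^{m+1}(t,-r)\phi_x(t,-r)\}dt$$ for all $\phi\in C^{2,1}(\overline{Q_T})$ with $\phi\ge0$, $\phi(t,\pm r)=0$ on $[0,T]$. A finite traveling wave solution with speed $c$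 is a weak solution $u(t,x)=\phi(x-ct)$ with $\phi(z)\equiv0$ for $z\ge w$ (or $z\le w$) for some $w\in\mathbb{R}$. The wave variable $\xi=x-ct$ and the desingularized variable $z$ are related by $dz/d\xi=\phi(\xi)^{-m}$; dots denote $d/dz$. "With oscillation" means that $\phi(\xi)-a$ changes sign infinitely often as $\xi\to+\infty$. *)

theory Defs
  imports "HOL-Analysis.Analysis"
begin

text \<open>
  Weak solutions of \<open>u_t = (1/(m+1)) (u^(m+1))_xx + f(u)\<close> on the line.  A function of
  \<open>(t, x)\<close> is a curried \<open>real \<Rightarrow> real \<Rightarrow> real\<close>, time first.
\<close>

definition reaction :: "real \<Rightarrow> real \<Rightarrow> real \<Rightarrow> real" where
  "reaction p a u = u powr p * (1 - u) * (u - a)"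

definition QT :: "real \<Rightarrow> (real \<times> real) set" where
  "QT T = {0<..<T} \<times> UNIV"

definition Linfty_on :: "(real \<times> real) set \<Rightarrow> (real \<Rightarrow> real \<Rightarrow> real) \<Rightarrow> bool" where
  "Linfty_on Q u \<longleftrightarrow>
     case_prod u \<in> borel_measurable (lebesgue_on Q) \<and>
     (\<exists>C. AE q in lebesgue_on Q. \<bar>case_prod u q\<bar> \<le> C)"

text \<open>
  The space \<open>C^{2,1}\<close> of the closed strip: \<open>\<phi>\<close> is \<open>C\<^sup>2\<close> in \<open>x\<close> and \<open>C\<^sup>1\<close> in \<open>t\<close>,
  with all these derivatives jointly continuous up to the boundary.  Time derivatives are
  one-sided at \<open>t = 0\<close> and \<open>t = T\<close>.  The derivatives \<open>\<phi>_t\<close>, \<open>\<phi>_x\<close>, \<open>\<phi>_xx\<close>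
  are passed as the arguments \<open>\<phi>t\<close>, \<open>\<phi>x\<close>, \<open>\<phi>xx\<close>.
\<close>

definition C21_strip ::
  "real \<Rightarrow> (real \<Rightarrow> real \<Rightarrow> real) \<Rightarrow> (real \<Rightarrow> real \<Rightarrow> real) \<Rightarrow>
   (real \<Rightarrow> real \<Rightarrow> real) \<Rightarrow> (real \<Rightarrow> real \<Rightarrow> real) \<Rightarrow> bool" where
  "C21_strip T \<phi> \<phi>t \<phi>x \<phi>xx \<longleftrightarrow>
     (\<forall>t\<in>{0..T}. \<forall>x.
        ((\<lambda>s. \<phi> s x) has_real_derivative \<phi>t t x) (at t within {0..T}) \<and>
        (\<phi> t has_real_derivative \<phi>x t x) (at x) \<and>
        (\<phi>x t has_real_derivative \<phi>xx t x) (at x)) \<and>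
     continuous_on ({0..T} \<times> UNIV) (case_prod \<phi>) \<and>
     continuous_on ({0..T} \<times> UNIV) (case_prod \<phi>t) \<and>
     continuous_on ({0..T} \<times> UNIV) (case_prod \<phi>x) \<and>
     continuous_on ({0..T} \<times> UNIV) (case_prod \<phi>xx)"

definition weak_identity ::
  "real \<Rightarrow> (real \<Rightarrow> real) \<Rightarrow> (real \<Rightarrow> real) \<Rightarrow> (real \<Rightarrow> real \<Rightarrow> real) \<Rightarrow> real \<Rightarrow> real \<Rightarrow>
   (real \<Rightarrow> real \<Rightarrow> real) \<Rightarrow> (real \<Rightarrow> real \<Rightarrow> real) \<Rightarrow>
   (real \<Rightarrow> real \<Rightarrow> real) \<Rightarrow> (real \<Rightarrow> real \<Rightarrow> real) \<Rightarrow> bool" where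
  "weak_identity m f u0 u r T \<phi> \<phi>t \<phi>x \<phi>xx \<longleftrightarrow>
     (let d = 1 / (m + 1) in
      integral {0..T} (\<lambda>t. integral {-r..r} (\<lambda>x.
          u t x * \<phi>t t x + d * (u t x) powr (m + 1) * \<phi>xx t x + f (u t x) * \<phi> t x))
      = integral {-r..r} (\<lambda>x. u T x * \<phi> T x - u0 x * \<phi> 0 x)
        + d * integral {0..T} (\<lambda>t.
            (u t r) powr (m + 1) * \<phi>x t r - (u t (-r)) powr (m + 1) * \<phi>x t (-r)))"

text \<open>
  The sign condition on test functions is imposed on the cylinder \<open>[0,T] \<times> [-r,r]\<close> of
  integration only: a test function vanishing at \<open>x = \<plusminus>r\<close> and nonnegative on the
  whole strip would have \<open>\<phi>_x(t, \<plusminus>r) = 0\<close>, making the boundary terms of the identity void.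
\<close>

definition weak_solution ::
  "real \<Rightarrow> (real \<Rightarrow> real) \<Rightarrow> (real \<Rightarrow> real) \<Rightarrow> (real \<Rightarrow> real \<Rightarrow> real) \<Rightarrow> bool" where
  "weak_solution m f u0 u \<longleftrightarrow>
     continuous_on UNIV u0 \<and> (\<forall>x. 0 \<le> u0 x \<and> u0 x \<le> 1) \<and>
     (\<forall>t>0. \<forall>x. 0 \<le> u t x) \<and>
     (\<forall>r>0. \<forall>T>0.
        continuous_on (QT T) (case_prod u) \<and> Linfty_on (QT T) u \<and>
        (\<forall>\<phi> \<phi>t \<phi>x \<phi>xx.
           C21_strip T \<phi> \<phi>t \<phi>x \<phi>xx \<longrightarrow>
           (\<forall>t\<in>{0..T}. \<forall>x\<in>{-r..r}. 0 \<le> \<phi> t x) \<longrightarrow>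
           (\<forall>t\<in>{0..T}. \<phi> t r = 0 \<and> \<phi> t (-r) = 0) \<longrightarrow>
           weak_identity m f u0 u r T \<phi> \<phi>t \<phi>x \<phi>xx))"

text \<open>The initial datum of the wave \<open>u(t,x) = \<phi>(x - ct)\<close> is its value \<open>\<phi>\<close> at \<open>t = 0\<close>.\<close>

definition finite_travelling_wave ::
  "real \<Rightarrow> (real \<Rightarrow> real) \<Rightarrow> real \<Rightarrow> (real \<Rightarrow> real) \<Rightarrow> bool" where
  "finite_travelling_wave m f c \<phi> \<longleftrightarrow>
     weak_solution m f \<phi> (\<lambda>t x. \<phi> (x - c * t)) \<and>
     (\<exists>w. (\<forall>z\<ge>w. \<phi> z = 0) \<or> (\<forall>z\<le>w. \<phi> z = 0))"

definition changes_sign_infinitely_often :: "(real \<Rightarrow> real) \<Rightarrow> bool" where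
  "changes_sign_infinitely_often g \<longleftrightarrow>
     (\<exists>s :: nat \<Rightarrow> real. strict_mono s \<and> filterlim s at_top sequentially \<and>
        (\<forall>n. g (s n) * g (s (Suc n)) < 0))"

definition tends_with_oscillation :: "(real \<Rightarrow> real) \<Rightarrow> real \<Rightarrow> bool" where
  "tends_with_oscillation \<phi> a \<longleftrightarrow>
     (\<phi> \<longlongrightarrow> a) at_top \<and> changes_sign_infinitely_often (\<lambda>\<xi>. \<phi> \<xi> - a)"

definition connecting_orbit ::
  "real \<Rightarrow> real \<Rightarrow> (real \<Rightarrow> real) \<Rightarrow> (real \<Rightarrow> real) \<Rightarrow> bool" where
  "connecting_orbit a c \<Phi> \<Psi> \<longleftrightarrow>
     (\<forall>z. (\<Phi> has_real_derivative \<Psi> z) (at z) \<and>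
          (\<Psi> has_real_derivative (- c * \<Psi> z - \<Phi> z * (1 - \<Phi> z) * (\<Phi> z - a))) (at z)) \<and>
     ((\<lambda>z. (\<Phi> z, \<Psi> z)) \<longlongrightarrow> (0, 0)) at_bot \<and>
     ((\<lambda>z. (\<Phi> z, \<Psi> z)) \<longlongrightarrow> (a, 0)) at_top"

text \<open>
  \<open>\<phi>\<close> on \<open>(\<xi>min, \<infinity>)\<close> is \<open>\<Phi>\<close> read in the variable \<open>\<xi>\<close>, where
  \<open>dz/d\<xi> = \<phi>(\<xi>)^(-m)\<close>.  The whole orbit, \<open>z\<close> ranging over all reals, corresponds to
  \<open>(\<xi>min, \<infinity>)\<close>.  Positivity is needed because \<open>0 powr (-m) = 0\<close>.
\<close>

definition desingularized_by ::
  "real \<Rightarrow> real \<Rightarrow> (real \<Rightarrow> real) \<Rightarrow> (real \<Rightarrow> real) \<Rightarrow> bool" where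
  "desingularized_by m \<xi>min \<phi> \<Phi> \<longleftrightarrow>
     (\<forall>\<xi>>\<xi>min. 0 < \<phi> \<xi>) \<and>
     (\<exists>Z. bij_betw Z {\<xi>min<..} UNIV \<and>
          (\<forall>\<xi>>\<xi>min. (Z has_real_derivative (\<phi> \<xi>) powr (- m)) (at \<xi>) \<and> \<phi> \<xi> = \<Phi> (Z \<xi>)))"

end

theory Submission
  imports Defs
begin

text \<open>
  Let \<open>G\<close> be the primitive of \<open>u (1 - u) (u - a)\<close> with \<open>G 0 = 0\<close>.  The energy \<open>\<psi>\<^sup>2/2 + G \<phi>\<close> has
  \<open>z\<close>-derivative \<open>-c \<psi>\<^sup>2\<close>, so along the branch of the unstable manifold of the saddle \<open>(0, 0)\<close> that
  enters \<open>\<phi> > 0\<close> it is negative.  Since \<open>G 1 > 0\<close> for \<open>a < 1/2\<close>, this traps the branch in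
  \<open>0 < \<phi> < 1\<close>, and it must converge to \<open>(a, 0)\<close>, which is a spiral because \<open>c\<^sup>2 < 4 a (1 - a)\<close>.

  The branch is built as \<open>\<phi> = s y(s)\<close> with \<open>s = e\<^bsup>lz\<^esup>\<close>, \<open>l\<^sup>2 + c l = a\<close>: in this variable the saddle becomes
  a regular initial point with \<open>y 0 = 1\<close>, and a contraction in an exponentially weighted sup norm gives
  \<open>y\<close> on the whole half line.

  In the physical variable the profile, extended by \<open>0\<close>, is \<open>C\<^sup>1\<close> since \<open>\<phi>_\<xi> = \<psi> \<phi>\<^bsup>-m\<^esup>\<close> is of
  order \<open>\<phi>\<^bsup>1-m\<^esup>\<close>, and its flux \<open>\<phi>\<^sup>m \<phi>_\<xi> = \<psi>\<close> is \<open>C\<^sup>1\<close> too.  So the wave solves the equation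
  classically, and the weak identity is integration by parts.
\<close>

section \<open>Damped oscillators and limits\<close>

lemma tendsto_exp_mult_at_bot:
  assumes "l > (0 :: real)"
  shows "((\<lambda>z. exp (l * z)) \<longlongrightarrow> 0) at_bot"
proof -
  have "filterlim (\<lambda>z. l * z) at_bot at_bot"
    using assms by (simp add: filterlim_tendsto_pos_mult_at_bot[OF tendsto_const] filterlim_ident)
  then show ?thesis by (rule filterlim_compose[OF exp_at_bot])
qed

text \<open>A form of Barbalat's lemma. Convergence of \<open>f\<close> and the mean value theorem
  give a point near \<open>x\<close> where \<open>f'\<close> is small, and the bound on
  \<open>f''\<close> carries the smallness over to \<open>x\<close>.\<close>

lemma derivative_tendsto_0_at_top:
  fixes f :: "real \<Rightarrow> real"
  assumes lim: "(f \<longlongrightarrow> l) at_top"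
    and f': "\<And>x. (f has_real_derivative f' x) (at x)"
    and f'': "\<And>x. (f' has_real_derivative f'' x) (at x)"
    and bound: "\<And>x. \<bar>f'' x\<bar> \<le> K"
  shows "(f' \<longlongrightarrow> 0) at_top"
proof (rule tendstoI)
  fix e :: real assume e: "e > 0"
  have K: "K \<ge> 0" using bound[of 0] by linarith
  \<comment> \<open>Over a distance \<open>h\<close> the derivative changes by at most
    \<open>e / 2\<close>; the difference quotient over \<open>h\<close> supplies the other
    half.\<close>
  define h where "h = e / (2 * (K + 1))"
  have h: "h > 0" "K * h \<le> e / 2"
    using e K by (simp_all add: h_def field_simps)
  have "((\<lambda>x. f (x + h) - f x) \<longlongrightarrow> l - l) at_top"
  proof (intro tendsto_diff lim filterlim_compose[OF lim])
    show "filterlim (\<lambda>x. x + h) at_top at_top"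
      using filterlim_tendsto_add_at_top[OF tendsto_const[of h] filterlim_ident]
      by (simp add: add.commute)
  qed
  then have "eventually (\<lambda>x. dist (f (x + h) - f x) 0 < h * (e / 2)) at_top"
    using h e by (intro tendstoD) auto
  then show "eventually (\<lambda>x. dist (f' x) 0 < e) at_top"
  proof eventually_elim
    case (elim x)
    obtain \<theta> where \<theta>: "x < \<theta>" "\<theta> < x + h" "f (x + h) - f x = h * f' \<theta>"
      using MVT2[of x "x + h" f f'] f' h by auto
    obtain \<zeta> where \<zeta>: "f' \<theta> - f' x = (\<theta> - x) * f'' \<zeta>"
      using MVT2[of x \<theta> f' f''] f'' \<theta> by auto
    have "\<bar>f' \<theta> - f' x\<bar> \<le> h * K"
      unfolding \<zeta> abs_mult using \<theta> bound[of \<zeta>] K by (intro mult_mono) auto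
    moreover have "\<bar>f' \<theta>\<bar> < e / 2"
      using elim \<theta>(3) h(1) by (simp add: abs_mult)
    ultimately show ?case using h(2) by (simp add: mult.commute)
  qed
qed

text \<open>A function that falls at a fixed positive rate becomes negative. The conclusion is a
  bound on the rate, so that it can be applied with an expression for \<open>\<epsilon>\<close>
  whose sign is wanted.\<close>

lemma ge_0_at_top_imp_derivative_not_le_neg:
  fixes g :: "real \<Rightarrow> real"
  assumes g': "\<And>x. x \<ge> z \<Longrightarrow> (g has_real_derivative g' x) (at x)"
    and le: "\<And>x. x \<ge> z \<Longrightarrow> g' x \<le> - \<epsilon>" and nonneg: "\<And>x. x \<ge> z \<Longrightarrow> g x \<ge> 0"
  shows "\<epsilon> \<le> 0"
proof (rule ccontr)
  assume "\<not> \<epsilon> \<le> 0"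
  then have \<epsilon>: "\<epsilon> > 0" by simp
  \<comment> \<open>Falling at rate \<open>\<epsilon>\<close> from \<open>z\<close> to this point
    costs \<open>g z + 1\<close>, more than is available.\<close>
  define x where "x = z + (g z + 1) / \<epsilon>"
  have x: "x > z" using nonneg[of z] \<epsilon> by (simp add: x_def)
  obtain \<theta> where "z < \<theta>" "g x - g z = (x - z) * g' \<theta>"
    using MVT2[of z x g g'] g' x by auto
  then have "g x - g z \<le> (x - z) * (- \<epsilon>)"
    using mult_left_mono[OF le[of \<theta>], of "x - z"] x by simp
  also have "\<dots> = - (g z + 1)" using \<epsilon> by (simp add: x_def)
  finally show False using nonneg[of x] x by simp
qed

text \<open>The substitution \<open>v = e\<^bsup>cz/2\<^esup> \<eta>\<close> removes the damping and makes a nonnegative solution concave.\<close>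
lemma damped_oscillator_eventually_nonneg_imp_0:
  fixes \<eta> \<psi> q :: "real \<Rightarrow> real"
  assumes \<eta>: "\<And>z. (\<eta> has_real_derivative \<psi> z) (at z)"
    and \<psi>: "\<And>z. (\<psi> has_real_derivative (- c * \<psi> z - q z * \<eta> z)) (at z)"
    and q: "\<And>z. z \<ge> Z \<Longrightarrow> q z \<ge> c\<^sup>2 / 4 + \<delta>" and \<delta>: "\<delta> > 0"
    and nonneg: "\<And>z. z \<ge> Z \<Longrightarrow> \<eta> z \<ge> 0"
    and z: "z \<ge> Z"
  shows "\<eta> z = 0"
proof -
  define v where "v z = exp (c / 2 * z) * \<eta> z" for z
  define v1 where "v1 z = exp (c / 2 * z) * (\<psi> z + c / 2 * \<eta> z)" for z
  have v: "(v has_real_derivative v1 z) (at z)" for z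
    unfolding v_def[abs_def] v1_def
    by (auto intro!: derivative_eq_intros \<eta> simp: algebra_simps)
  have v1: "(v1 has_real_derivative (c\<^sup>2 / 4 - q z) * v z) (at z)" for z
    unfolding v_def v1_def[abs_def]
    by (auto intro!: derivative_eq_intros \<eta> \<psi> simp: algebra_simps power2_eq_square)
  have vpos: "v z \<ge> 0" if "z \<ge> Z" for z
    using nonneg[OF that] by (simp add: v_def)
  have v2: "(c\<^sup>2 / 4 - q z) * v z \<le> - \<delta> * v z" if "z \<ge> Z" for z
    using q[OF that] vpos[OF that] by (intro mult_right_mono) auto
  have v1_anti: "v1 y \<le> v1 x" if "Z \<le> x" "x \<le> y" for x y
  proof (rule DERIV_nonpos_imp_nonincreasing[OF that(2)])
    fix t assume t: "x \<le> t" "t \<le> y"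
    then have "t \<ge> Z" using that by simp
    then have "(c\<^sup>2 / 4 - q t) * v t \<le> 0"
      using v2[of t] vpos[of t] \<delta> mult_nonneg_nonneg[of \<delta> "v t"] by linarith
    with v1[of t] show "\<exists>y. (v1 has_real_derivative y) (at t) \<and> y \<le> 0" by blast
  qed
  \<comment> \<open>A negative slope of \<open>v\<close> would stay below its present value, as
    \<open>v1\<close> is nonincreasing, and would drive \<open>v\<close> below zero.\<close>
  have v1_nonneg: "v1 x \<ge> 0" if "x \<ge> Z" for x
  proof -
    have "- v1 x \<le> 0"
      by (rule ge_0_at_top_imp_derivative_not_le_neg[of x v v1])
         (use that v v1_anti vpos in auto)
    then show ?thesis by simp
  qed
  have v_mono: "v x \<le> v y" if "Z \<le> x" "x \<le> y" for x y
    by (rule DERIV_nonneg_imp_nondecreasing[OF that(2)]) (use v v1_nonneg that in force)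
  \<comment> \<open>Now \<open>v\<close> is nondecreasing, so \<open>v1\<close> falls at rate at
    least \<open>\<delta> * v z\<close> from \<open>z\<close> on; since \<open>v1\<close> stays
    nonnegative, this rate cannot be positive.\<close>
  have "\<delta> * v z \<le> 0"
  proof (rule ge_0_at_top_imp_derivative_not_le_neg[of z v1])
    fix x assume x: "x \<ge> z"
    show "(v1 has_real_derivative (c\<^sup>2 / 4 - q x) * v x) (at x)" by (rule v1)
    show "v1 x \<ge> 0" using v1_nonneg x z by simp
    have "\<delta> * v z \<le> \<delta> * v x" using v_mono[of z x] x z \<delta> by simp
    then show "(c\<^sup>2 / 4 - q x) * v x \<le> - (\<delta> * v z)" using v2[of x] x z by simp
  qed
  then have "v z \<le> 0" using \<delta> by (simp add: mult_le_0_iff)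
  then show ?thesis using nonneg[OF z] by (simp add: v_def mult_le_0_iff)
qed

text \<open>A Gronwall argument: the squared norm of the state, weighted by
  \<open>exp (K * z)\<close>, is nondecreasing, so a zero at \<open>Z\<close> forces zeros at all
  earlier times.\<close>

lemma damped_oscillator_backward_unique:
  fixes \<eta> \<psi> q :: "real \<Rightarrow> real"
  assumes \<eta>: "\<And>z. (\<eta> has_real_derivative \<psi> z) (at z)"
    and \<psi>: "\<And>z. (\<psi> has_real_derivative (- c * \<psi> z - q z * \<eta> z)) (at z)"
    and q: "\<And>z. \<bar>q z\<bar> \<le> Q"
    and zero: "\<eta> Z = 0" "\<psi> Z = 0" and z: "z \<le> Z"
  shows "\<eta> z = 0"
proof -
  \<comment> \<open>The three summands absorb, in turn, the cross term
    \<open>2 * \<eta> * \<psi>\<close>, the term with \<open>q\<close> and the damping.\<close>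
  define K where "K = 1 + Q + 2 * \<bar>c\<bar>"
  define W where "W z = exp (K * z) * ((\<eta> z)\<^sup>2 + (\<psi> z)\<^sup>2)" for z
  define W1 where "W1 z = exp (K * z) * (K * ((\<eta> z)\<^sup>2 + (\<psi> z)\<^sup>2) + 2 * \<eta> z * \<psi> z - 2 * c * (\<psi> z)\<^sup>2 - 2 * q z * \<eta> z * \<psi> z)" for z
  have W: "(W has_real_derivative W1 z) (at z)" for z
    unfolding W_def[abs_def] W1_def
    by (auto intro!: derivative_eq_intros \<eta> \<psi> simp: algebra_simps power2_eq_square)
  have W1: "W1 z \<ge> 0" for z
  proof -
    have s: "\<bar>2 * \<eta> z * \<psi> z\<bar> \<le> (\<eta> z)\<^sup>2 + (\<psi> z)\<^sup>2"
      using zero_le_power2[of "\<eta> z - \<psi> z"] zero_le_power2[of "\<eta> z + \<psi> z"]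
      by (simp add: power2_eq_square algebra_simps abs_le_iff)
    have "\<bar>q z * (2 * \<eta> z * \<psi> z)\<bar> \<le> Q * ((\<eta> z)\<^sup>2 + (\<psi> z)\<^sup>2)"
      unfolding abs_mult[of "q z"] using s q[of z] by (intro mult_mono) auto
    moreover have "c * (\<psi> z)\<^sup>2 \<le> \<bar>c\<bar> * ((\<eta> z)\<^sup>2 + (\<psi> z)\<^sup>2)"
      by (intro mult_mono) auto
    ultimately have "0 \<le> K * ((\<eta> z)\<^sup>2 + (\<psi> z)\<^sup>2) + 2 * \<eta> z * \<psi> z - 2 * c * (\<psi> z)\<^sup>2 - 2 * q z * \<eta> z * \<psi> z"
      using s unfolding K_def by (simp add: algebra_simps)
    then show ?thesis by (simp add: W1_def)
  qed
  have "W z \<le> W Z"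
    by (rule DERIV_nonneg_imp_nondecreasing[OF z]) (use W W1 in blast)
  then have "(\<eta> z)\<^sup>2 + (\<psi> z)\<^sup>2 \<le> 0" using zero by (simp add: W_def mult_le_0_iff)
  then show ?thesis by (simp add: sum_power2_le_zero_iff)
qed

text \<open>A solution that is nonnegative from some time on vanishes from some time on, and
  backward uniqueness then makes it vanish at all earlier times. Applied to both
  \<open>\<eta>\<close> and \<open>- \<eta>\<close>, this yields oscillation.\<close>

lemma damped_oscillator_neg_arbitrarily_late:
  fixes \<eta> \<psi> q :: "real \<Rightarrow> real"
  assumes \<eta>: "\<And>z. (\<eta> has_real_derivative \<psi> z) (at z)"
    and \<psi>: "\<And>z. (\<psi> has_real_derivative (- c * \<psi> z - q z * \<eta> z)) (at z)"
    and Q: "\<And>z. \<bar>q z\<bar> \<le> Q"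
    and q: "eventually (\<lambda>z. q z \<ge> c\<^sup>2 / 4 + \<delta>) at_top" and \<delta>: "\<delta> > 0"
    and nontrivial: "\<And>Z. \<exists>z\<le>Z. \<eta> z \<noteq> 0"
  shows "\<exists>z>Z. \<eta> z < 0"
proof (rule ccontr)
  assume "\<not> ?thesis"
  then have nonneg: "\<eta> z \<ge> 0" if "z > Z" for z using that by force
  obtain N where N: "\<And>z. z \<ge> N \<Longrightarrow> q z \<ge> c\<^sup>2 / 4 + \<delta>"
    using q by (auto simp: eventually_at_top_linorder)
  define Y where "Y = max N (Z + 1)"
  have zero: "\<eta> z = 0" if "z \<ge> Y" for z
    by (rule damped_oscillator_eventually_nonneg_imp_0[OF \<eta> \<psi> _ \<delta> _ that])
      (use N nonneg in \<open>auto simp: Y_def\<close>)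
  \<comment> \<open>Since \<open>Y + 1\<close> is interior to the half line where
    \<open>\<eta>\<close> vanishes, the derivative \<open>\<psi>\<close> vanishes there too.\<close>
  have "((\<lambda>z. 0) has_real_derivative \<psi> (Y + 1)) (at (Y + 1))"
    by (rule has_field_derivative_transform_within_open[OF \<eta>, where S = "{Y<..}"]) (use zero in auto)
  then have "\<psi> (Y + 1) = 0" by (metis DERIV_const DERIV_unique)
  with damped_oscillator_backward_unique[OF \<eta> \<psi> Q zero[of "Y + 1"]] nontrivial[of "Y + 1"]
  show False by auto
qed

section \<open>The unstable manifold of the saddle\<close>

text \<open>Contraction for the unknown \<open>exp (- \<beta> * s) * y s\<close> in the bounded
  continuous functions; the exponential weight gives the whole half line at once. Scaling the upper
  limit \<open>s\<close> into the integrand leaves a fixed interval, so continuity in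
  \<open>s\<close> is that of a parameter integral.\<close>

lemma weighted_volterra_fixpoint:
  fixes M :: "real \<Rightarrow> real \<Rightarrow> real" and w :: "real \<Rightarrow> real"
  assumes cont: "continuous_on UNIV (\<lambda>(s, y). M s y)"
    and bound: "\<And>s y. s \<ge> 0 \<Longrightarrow> \<bar>M s y\<bar> \<le> B"
    and lips: "\<And>s y y'. s \<ge> 0 \<Longrightarrow> \<bar>M s y - M s y'\<bar> \<le> L * \<bar>y - y'\<bar>"
    and w: "continuous_on {0..1} w" "\<And>\<tau>. \<tau> \<in> {0..1} \<Longrightarrow> \<bar>w \<tau>\<bar> \<le> 1"
    and C: "C \<ge> 0" and L: "L \<ge> 0"
  obtains y where "continuous_on UNIV y"
    "\<And>s. s \<ge> 0 \<Longrightarrow> y s = y0 + C * s * integral {0..1} (\<lambda>\<tau>. w \<tau> * M (s * \<tau>) (y (s * \<tau>)))"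
proof -
  \<comment> \<open>This makes the contraction factor \<open>C * L / \<beta>\<close> at most 1/2;
    the summand 1 keeps \<open>\<beta>\<close> positive.\<close>
  define \<beta> where "\<beta> = 2 * C * L + 1"
  have \<beta>: "\<beta> > 0" using C L by (simp add: \<beta>_def add_nonneg_pos)
  define J where "J h s = integral {0..1} (\<lambda>\<tau>. w \<tau> * M (s * \<tau>) (h (s * \<tau>)))" for h s
  have contM: "continuous_on S (\<lambda>x. M (f x) (g x))"
    if "continuous_on S f" "continuous_on S g" for f g :: "'a::topological_space \<Rightarrow> real" and S
    using continuous_on_compose2[OF cont continuous_on_Pair[OF that]] by simp
  have contJ: "continuous_on UNIV (J h)" if "continuous_on UNIV h" for h
  proof -
    have "continuous_on (UNIV \<times> cbox 0 1) (\<lambda>(s, \<tau>). w \<tau> * M (s * \<tau>) (h (s * \<tau>)))"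
      unfolding split_beta
      by (intro continuous_intros contM continuous_on_compose2[OF w(1)]
            continuous_on_compose2[OF that]) auto
    from integral_continuous_on_param[OF this] show ?thesis by (simp add: J_def[abs_def])
  qed
  have int: "(\<lambda>\<tau>. w \<tau> * M (s * \<tau>) (h (s * \<tau>))) integrable_on {0..1}"
    if "continuous_on UNIV h" for h s
    by (intro integrable_continuous_interval continuous_intros contM w(1)
            continuous_on_compose2[OF that]) auto
  have J_le: "\<bar>J h s\<bar> \<le> B" if "continuous_on UNIV h" "s \<ge> 0" for h s
  proof -
    have "norm (J h s) \<le> integral {0..1} (\<lambda>\<tau>::real. B)"
      unfolding J_def
    proof (rule integral_norm_bound_integral[OF int[OF that(1)]])
      fix \<tau> :: real assume "\<tau> \<in> {0..1}"
      then show "norm (w \<tau> * M (s * \<tau>) (h (s * \<tau>))) \<le> B"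
        using mult_mono[OF w(2) bound[of "s * \<tau>" "h (s * \<tau>)"], of \<tau>] that(2)
        by (simp add: abs_mult)
    qed auto
    then show ?thesis by simp
  qed
  have B: "B \<ge> 0" using bound[of 0 0] by linarith
  \<comment> \<open>The fixed point map in the weighted unknown. Freezing it at
    \<open>max 0 t\<close> extends it to negative \<open>t\<close>, because the function space lives
    on the whole line.\<close>
  define T where "T Y t = exp (- \<beta> * max 0 t) * (y0 + C * max 0 t * J (\<lambda>s. exp (\<beta> * s) * apply_bcontfun Y s) (max 0 t))"
    for Y :: "real \<Rightarrow>\<^sub>C real" and t
  have hY: "continuous_on UNIV (\<lambda>s. exp (\<beta> * s) * apply_bcontfun Y s)" for Y :: "real \<Rightarrow>\<^sub>C real"
    by (intro continuous_intros continuous_on_apply_bcontfun)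
  have s_exp: "s * exp (- \<beta> * s) \<le> 1 / \<beta>" for s
  proof -
    have "\<beta> * s \<le> exp (\<beta> * s)" using exp_ge_add_one_self[of "\<beta> * s"] by linarith
    then show ?thesis using \<beta> by (simp add: exp_minus field_simps)
  qed
  have "T Y \<in> bcontfun" for Y
  proof -
    have "continuous_on UNIV (T Y)"
      unfolding T_def[abs_def]
      by (intro continuous_intros continuous_on_compose2[OF contJ[OF hY]]) auto
    moreover have "norm (T Y t) \<le> \<bar>y0\<bar> + C * B / \<beta>" for t
    proof -
      define s where "s = max 0 t"
      have s: "s \<ge> 0" by (simp add: s_def)
      let ?J = "J (\<lambda>s. exp (\<beta> * s) * apply_bcontfun Y s) s"
      have "norm (T Y t) = exp (- \<beta> * s) * \<bar>y0 + C * s * ?J\<bar>"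
        by (simp add: T_def s_def abs_mult)
      also have "\<dots> \<le> exp (- \<beta> * s) * (\<bar>y0\<bar> + C * s * B)"
      proof (intro mult_left_mono)
        have "\<bar>C * s * ?J\<bar> \<le> C * s * B"
          using J_le[OF hY s, of Y] C s by (simp add: abs_mult mult_left_mono)
        then show "\<bar>y0 + C * s * ?J\<bar> \<le> \<bar>y0\<bar> + C * s * B" by linarith
      qed simp
      also have "\<dots> = exp (- \<beta> * s) * \<bar>y0\<bar> + C * B * (s * exp (- \<beta> * s))"
        by (simp add: algebra_simps)
      also have "\<dots> \<le> 1 * \<bar>y0\<bar> + C * B * (1 / \<beta>)"
        using s_exp[of s] C B \<beta> s by (intro add_mono mult_mono mult_left_mono) auto
      finally show ?thesis by simp
    qed
    ultimately show ?thesis by (auto simp: bcontfun_def bounded_iff)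
  qed
  then have app: "apply_bcontfun (Bcontfun (T Y)) = T Y" for Y
    by (simp add: Bcontfun_inverse)
  have contr: "dist (Bcontfun (T Y)) (Bcontfun (T Z)) \<le> 1/2 * dist Y Z" for Y Z
  proof (rule dist_bound)
    fix t :: real
    define s where "s = max 0 t"
    have s: "s \<ge> 0" by (simp add: s_def)
    define D where "D = dist Y Z"
    have D: "D \<ge> 0" by (simp add: D_def)
    have dYZ: "\<bar>apply_bcontfun Y x - apply_bcontfun Z x\<bar> \<le> D" for x
      using dist_bounded[of Y x Z] by (simp add: D_def dist_real_def)
    let ?Y = "\<lambda>s. exp (\<beta> * s) * apply_bcontfun Y s" and ?Z = "\<lambda>s. exp (\<beta> * s) * apply_bcontfun Z s"
    \<comment> \<open>With the factor \<open>\<beta> * s\<close> kept inside, the formula also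
      covers \<open>s = 0\<close>.\<close>
    have I: "((\<lambda>\<tau>. \<beta> * s * exp (\<beta> * s * \<tau>)) has_integral (exp (\<beta> * s) - 1)) {0..1}"
    proof -
      have "((\<lambda>\<tau>. \<beta> * s * exp (\<beta> * s * \<tau>)) has_integral (exp (\<beta> * s * 1) - exp (\<beta> * s * 0))) {0..1}"
        by (rule fundamental_theorem_of_calculus)
          (auto intro!: derivative_eq_intros simp flip: has_real_derivative_iff_has_vector_derivative)
      then show ?thesis by simp
    qed
    have "norm (s * (J ?Y s - J ?Z s)) \<le> L * D / \<beta> * (exp (\<beta> * s) - 1)"
    proof -
      have "norm (J ?Y s - J ?Z s)
          = norm (integral {0..1} (\<lambda>\<tau>. w \<tau> * M (s * \<tau>) (?Y (s * \<tau>)) - w \<tau> * M (s * \<tau>) (?Z (s * \<tau>))))"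
        unfolding J_def by (subst integral_diff) (auto intro: int hY)
      also have "\<dots> \<le> integral {0..1} (\<lambda>\<tau>. L * D * exp (\<beta> * s * \<tau>))"
      proof (rule integral_norm_bound_integral)
        show "(\<lambda>\<tau>. w \<tau> * M (s * \<tau>) (?Y (s * \<tau>)) - w \<tau> * M (s * \<tau>) (?Z (s * \<tau>))) integrable_on {0..1}"
          by (intro integrable_diff int hY)
        show "(\<lambda>\<tau>. L * D * exp (\<beta> * s * \<tau>)) integrable_on {0..1}"
          by (intro integrable_continuous_interval continuous_intros)
        fix \<tau> :: real assume \<tau>: "\<tau> \<in> {0..1}"
        have "norm (w \<tau> * M (s * \<tau>) (?Y (s * \<tau>)) - w \<tau> * M (s * \<tau>) (?Z (s * \<tau>)))
            = \<bar>w \<tau>\<bar> * \<bar>M (s * \<tau>) (?Y (s * \<tau>)) - M (s * \<tau>) (?Z (s * \<tau>))\<bar>"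
          by (simp add: abs_mult flip: right_diff_distrib)
        also have "\<dots> \<le> 1 * (L * \<bar>?Y (s * \<tau>) - ?Z (s * \<tau>)\<bar>)"
          using \<tau> s w(2) L by (intro mult_mono lips) auto
        also have "1 * (L * \<bar>?Y (s * \<tau>) - ?Z (s * \<tau>)\<bar>) \<le> L * D * exp (\<beta> * s * \<tau>)"
        proof -
          have "\<bar>?Y (s * \<tau>) - ?Z (s * \<tau>)\<bar> \<le> D * exp (\<beta> * s * \<tau>)"
            using dYZ[of "s * \<tau>"] by (simp add: abs_mult mult.assoc mult.commute[of D] flip: right_diff_distrib)
          from mult_left_mono[OF this L] show ?thesis by (simp add: mult.assoc)
        qed
        finally show "norm (w \<tau> * M (s * \<tau>) (?Y (s * \<tau>)) - w \<tau> * M (s * \<tau>) (?Z (s * \<tau>)))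
            \<le> L * D * exp (\<beta> * s * \<tau>)" .
      qed
      finally have *: "norm (J ?Y s - J ?Z s) \<le> integral {0..1} (\<lambda>\<tau>. L * D * exp (\<beta> * s * \<tau>))" .
      have "norm (s * (J ?Y s - J ?Z s)) = s * norm (J ?Y s - J ?Z s)"
        using s by (simp add: abs_mult)
      also have "\<dots> \<le> s * integral {0..1} (\<lambda>\<tau>. L * D * exp (\<beta> * s * \<tau>))"
        using * s by (intro mult_left_mono)
      also have "\<dots> = integral {0..1} (\<lambda>\<tau>. L * D / \<beta> * (\<beta> * s * exp (\<beta> * s * \<tau>)))"
        using \<beta> by (simp flip: integral_mult_right add: field_simps)
      also have "\<dots> = L * D / \<beta> * (exp (\<beta> * s) - 1)"
        using integral_unique[OF I] by (subst integral_mult_right) simp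
      finally show ?thesis .
    qed
    also have "\<dots> \<le> L * D / \<beta> * exp (\<beta> * s)"
      using L D \<beta> by (intro mult_left_mono) auto
    finally have *: "\<bar>s * (J ?Y s - J ?Z s)\<bar> \<le> L * D / \<beta> * exp (\<beta> * s)" by simp
    have "dist (T Y t) (T Z t) = exp (- \<beta> * s) * (C * \<bar>s * (J ?Y s - J ?Z s)\<bar>)"
    proof -
      have "T Y t - T Z t = exp (- \<beta> * s) * (C * (s * (J ?Y s - J ?Z s)))"
        by (simp add: T_def s_def algebra_simps)
      then show ?thesis using C by (simp add: dist_real_def abs_mult)
    qed
    also have "\<dots> \<le> exp (- \<beta> * s) * (C * (L * D / \<beta> * exp (\<beta> * s)))"
      using * C by (intro mult_left_mono) auto
    also have "\<dots> = C * L / \<beta> * D" by (simp add: exp_minus field_simps)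
    also have "\<dots> \<le> 1/2 * D"
      using D \<beta> C L by (intro mult_right_mono) (auto simp: field_simps \<beta>_def)
    finally show "dist (apply_bcontfun (Bcontfun (T Y)) t) (apply_bcontfun (Bcontfun (T Z)) t) \<le> 1/2 * dist Y Z"
      by (simp add: app D_def)
  qed
  have "\<exists>!Y. Bcontfun (T Y) = Y"
    by (rule banach_fix_type[of "1/2"]) (use contr in auto)
  then obtain Y where "Bcontfun (T Y) = Y" by blast
  then have Y: "T Y t = apply_bcontfun Y t" for t using app by metis
  show ?thesis
  proof
    show "continuous_on UNIV (\<lambda>s. exp (\<beta> * s) * apply_bcontfun Y s)" by (rule hY)
    fix s :: real assume "s \<ge> 0"
    then show "exp (\<beta> * s) * apply_bcontfun Y s = y0 + C * s * integral {0..1}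
        (\<lambda>\<tau>. w \<tau> * M (s * \<tau>) (exp (\<beta> * (s * \<tau>)) * apply_bcontfun Y (s * \<tau>)))"
      unfolding Y[symmetric, of s] by (simp add: T_def J_def exp_minus)
  qed
qed

section \<open>The clamped nonlinearity\<close>

definition unit_clamp :: "real \<Rightarrow> real" where
  "unit_clamp y = max 0 (min 1 y)"

text \<open>For \<open>y\<close> and \<open>s y\<close> in \<open>[0, 1]\<close> this is the nonlinear part of the reaction at \<open>\<Phi> = s y\<close>, divided by
  \<open>s\<^sup>2\<close>.  The clamps make it globally Lipschitz in \<open>y\<close>, uniformly in \<open>s \<ge> 0\<close>.\<close>
definition clamped_source :: "real \<Rightarrow> real \<Rightarrow> real \<Rightarrow> real" where
  "clamped_source a s y = (unit_clamp y)\<^sup>2 * (min 1 (s * unit_clamp y) - (1 + a))"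

lemma unit_clamp_bounds: "0 \<le> unit_clamp y" "unit_clamp y \<le> 1"
  by (auto simp: unit_clamp_def)

lemma unit_clamp_eq: "0 \<le> y \<Longrightarrow> y \<le> 1 \<Longrightarrow> unit_clamp y = y"
  by (simp add: unit_clamp_def)

lemma clamped_source_nonpos: "a \<ge> 0 \<Longrightarrow> clamped_source a s y \<le> 0"
  by (auto simp: clamped_source_def mult_le_0_iff min_def)

lemma abs_clamped_source_le:
  assumes "a \<ge> 0" "s \<ge> 0" shows "\<bar>clamped_source a s y\<bar> \<le> 1 + a"
proof -
  have "(unit_clamp y)\<^sup>2 \<le> 1" using unit_clamp_bounds[of y] by (simp add: power_le_one)
  moreover have "\<bar>min 1 (s * unit_clamp y) - (1 + a)\<bar> \<le> 1 + a"
    using assms unit_clamp_bounds[of y] mult_nonneg_nonneg[of s "unit_clamp y"] by (auto simp: min_def)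
  ultimately have "(unit_clamp y)\<^sup>2 * \<bar>min 1 (s * unit_clamp y) - (1 + a)\<bar> \<le> 1 * (1 + a)"
    by (intro mult_mono) auto
  then show ?thesis by (simp add: clamped_source_def abs_mult)
qed

text \<open>The constant is independent of \<open>s\<close> although \<open>min 1 (s * t)\<close>
  alone has slope \<open>s\<close> in \<open>t\<close>: concavity bounds \<open>q\<close> times its
  increment by \<open>q - p\<close>, and the increment of the square contributes the remaining
  \<open>2 * (q - p)\<close>.\<close>

lemma square_min_lipschitz:
  fixes s :: real
  assumes "s \<ge> 0" "0 \<le> p" "p \<le> q" "q \<le> 1"
  shows "\<bar>q\<^sup>2 * min 1 (s * q) - p\<^sup>2 * min 1 (s * p)\<bar> \<le> 3 * (q - p)"
proof -
  have sp: "0 \<le> s * p" "s * p \<le> s * q" using assms by (auto intro: mult_left_mono)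
  have nn: "p\<^sup>2 * min 1 (s * p) \<le> q\<^sup>2 * min 1 (s * q)"
    using assms sp by (intro mult_mono power_mono) (auto simp: min_def)
  \<comment> \<open>\<open>t \<mapsto> min 1 (s t)\<close> is concave and vanishes at \<open>0\<close>.\<close>
  have "p * min 1 (s * q) \<le> q * min 1 (s * p)"
    using assms sp by (auto simp: min_def algebra_simps intro: mult_left_mono)
       (metis mult.assoc mult.commute mult_left_mono mult_right_mono order_trans mult_cancel_left2)+
  then have "q * (min 1 (s * q) - min 1 (s * p)) \<le> (q - p) * min 1 (s * q)"
    by (simp add: algebra_simps)
  also have "\<dots> \<le> (q - p) * 1" using assms by (intro mult_left_mono) auto
  finally have "q * (q * (min 1 (s * q) - min 1 (s * p))) \<le> 1 * (q - p)"
    using assms sp by (intro mult_mono) (auto simp: min_def)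
  moreover have "(q\<^sup>2 - p\<^sup>2) * min 1 (s * p) \<le> (q\<^sup>2 - p\<^sup>2) * 1"
    using assms by (intro mult_left_mono) (auto intro: power_mono)
  moreover have "q\<^sup>2 - p\<^sup>2 \<le> 2 * (q - p)"
  proof -
    have "q\<^sup>2 - p\<^sup>2 = (q + p) * (q - p)" by (simp add: power2_eq_square algebra_simps)
    also have "\<dots> \<le> 2 * (q - p)" using assms by (intro mult_right_mono) auto
    finally show ?thesis .
  qed
  ultimately show ?thesis using nn by (simp add: algebra_simps power2_eq_square)
qed

text \<open>Clamping does not increase distances. The constant is 3 for the product with the minimum
  plus \<open>2 * (1 + a)\<close> for the square.\<close>

lemma clamped_source_lipschitz:
  assumes a: "a \<ge> 0" and s: "s \<ge> 0"
  shows "\<bar>clamped_source a s y - clamped_source a s y'\<bar> \<le> (5 + 2 * a) * \<bar>y - y'\<bar>"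
proof (induction y y' rule: linorder_wlog)
  case (le y y')
  define p q where "p = unit_clamp y" and "q = unit_clamp y'"
  have pq: "0 \<le> p" "p \<le> q" "q \<le> 1" "q - p \<le> y' - y"
    using le by (auto simp: p_def q_def unit_clamp_def)
  have "\<bar>clamped_source a s y - clamped_source a s y'\<bar>
      = \<bar>(q\<^sup>2 * min 1 (s * q) - p\<^sup>2 * min 1 (s * p)) - (1 + a) * (q\<^sup>2 - p\<^sup>2)\<bar>"
    by (simp add: clamped_source_def p_def q_def algebra_simps)
  also have "\<dots> \<le> 3 * (q - p) + (1 + a) * \<bar>q\<^sup>2 - p\<^sup>2\<bar>"
    using square_min_lipschitz[OF s pq(1-3)] a
      abs_triangle_ineq4[of "q\<^sup>2 * min 1 (s * q) - p\<^sup>2 * min 1 (s * p)" "(1 + a) * (q\<^sup>2 - p\<^sup>2)"]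
    unfolding abs_mult[of "1 + a"] by linarith
  also have "\<bar>q\<^sup>2 - p\<^sup>2\<bar> = (q + p) * (q - p)"
    using pq by (simp add: power2_eq_square abs_if algebra_simps mult_mono)
      (smt (verit) mult_mono)
  also have "\<dots> \<le> 2 * (q - p)" using pq by (intro mult_right_mono) auto
  finally have "\<bar>clamped_source a s y - clamped_source a s y'\<bar> \<le> 3 * (q - p) + (1 + a) * (2 * (q - p))"
    using a by (simp add: mult_left_mono)
  also have "\<dots> = (5 + 2 * a) * (q - p)" by (simp add: algebra_simps)
  also have "\<dots> \<le> (5 + 2 * a) * (y' - y)" using pq a by (intro mult_left_mono) auto
  finally show ?case using le by simp
next
  case (sym y y')
  then show ?case by (simp add: abs_minus_commute)
qed

lemma continuous_on_clamped_source:
  "continuous_on S f \<Longrightarrow> continuous_on S g \<Longrightarrow> continuous_on S (\<lambda>x. clamped_source a (f x) (g x))"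
  unfolding clamped_source_def unit_clamp_def by (intro continuous_intros)

section \<open>The orbit leaving the saddle\<close>

text \<open>Here \<open>s = e\<^bsup>lz\<^esup>\<close> and \<open>y = \<Phi> / s\<close>, which solves an integral equation that is regular at \<open>s = 0\<close>.\<close>
lemma clamped_profile_exists:
  assumes a: "a \<ge> 0" and k: "k > 0" and l: "l \<noteq> 0"
  obtains y R where
    "continuous_on UNIV y" "y 0 = 1" "\<And>s. s \<ge> 0 \<Longrightarrow> y s \<le> 1"
    "\<And>s. s > 0 \<Longrightarrow> (y has_real_derivative R s / s\<^sup>2) (at s)"
    "\<And>s. s > 0 \<Longrightarrow> (R has_real_derivative ((1 - k) * R s / s + s * clamped_source a s (y s) / l\<^sup>2)) (at s)"
    "\<And>s. s > 0 \<Longrightarrow> \<bar>R s\<bar> \<le> (1 + a) / l\<^sup>2 * s\<^sup>2"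
proof -
  \<comment> \<open>With \<open>R = s\<^sup>2 * y'\<close>, the factor \<open>s powr (k - 1)\<close>
    integrates the equation for \<open>R\<close>. A second integration from \<open>y 0 = 1\<close>
    produces the kernel \<open>1 - \<tau> powr k\<close> and this constant.\<close>
  define C where "C = 1 / (l\<^sup>2 * k)"
  have C: "C \<ge> 0" using k by (simp add: C_def)
  obtain y where y: "continuous_on UNIV y"
    "\<And>s. s \<ge> 0 \<Longrightarrow> y s = 1 + C * s * integral {0..1} (\<lambda>\<tau>. (1 - \<tau> powr k) * clamped_source a (s * \<tau>) (y (s * \<tau>)))"
  proof (rule weighted_volterra_fixpoint[of "clamped_source a" "1 + a" "5 + 2 * a" "\<lambda>\<tau>. 1 - \<tau> powr k" C 1])
    show "continuous_on UNIV (\<lambda>(s, y). clamped_source a s y)"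
      unfolding split_beta by (intro continuous_on_clamped_source continuous_intros)
    show "continuous_on {0..1} (\<lambda>\<tau>. 1 - \<tau> powr k)"
      using k by (intro continuous_intros continuous_on_powr') auto
    show "\<bar>1 - \<tau> powr k\<bar> \<le> 1" if "\<tau> \<in> {0..1}" for \<tau>
      using that k by (auto simp: powr_le1)
  qed (use a C abs_clamped_source_le clamped_source_lipschitz in auto)
  define M where "M s = clamped_source a s (y s)" for s
  have contM: "continuous_on S M" for S
    unfolding M_def[abs_def]
    by (intro continuous_on_clamped_source continuous_intros continuous_on_subset[OF y(1)]) auto
  have contkM: "continuous_on {0..b} (\<lambda>\<sigma>. \<sigma> powr k * M \<sigma>)" for b
    using k by (intro continuous_intros contM continuous_on_powr') auto
  define A where "A s = integral {0..s} M" for s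
  define B where "B s = integral {0..s} (\<lambda>\<sigma>. \<sigma> powr k * M \<sigma>)" for s
  have A': "(A has_real_derivative M s) (at s)" if "s > 0" for s
    using integral_has_real_derivative[OF contM, of s 0 "s + 1"] that
    by (simp add: A_def[abs_def] at_within_Icc_at)
  have B': "(B has_real_derivative s powr k * M s) (at s)" if "s > 0" for s
    using integral_has_real_derivative[OF contkM, of s "s + 1"] that
    by (simp add: B_def[abs_def] at_within_Icc_at)
  \<comment> \<open>Substituting \<open>\<sigma> = s * \<tau>\<close> splits the kernel into two
    integrals whose integrands do not involve \<open>s\<close>, so that \<open>y\<close> can be
    differentiated.\<close>
  have yAB: "y s = 1 + C * (A s - s powr (-k) * B s)" if s: "s > 0" for s
  proof -
    have "((\<lambda>\<tau>. s *\<^sub>R ((1 - (s * \<tau> / s) powr k) * M (s * \<tau>))) has_integral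
        integral {s * 0..s * 1} (\<lambda>\<sigma>. (1 - (\<sigma> / s) powr k) * M \<sigma>)) {0..1}"
    proof (rule has_integral_substitution)
      show "continuous_on {0..s} (\<lambda>\<sigma>. (1 - (\<sigma> / s) powr k) * M \<sigma>)"
        using k s by (intro continuous_intros contM continuous_on_powr') auto
      show "((*) s has_real_derivative s) (at x within {0..1})" for x
        by (auto intro!: derivative_eq_intros)
    qed (use s in \<open>auto intro: mult_left_le\<close>)
    then have "s * integral {0..1} (\<lambda>\<tau>. (1 - \<tau> powr k) * M (s * \<tau>)) = integral {0..s} (\<lambda>\<sigma>. (1 - (\<sigma> / s) powr k) * M \<sigma>)"
      using s by (simp add: integral_unique flip: integral_mult_right)
    also have "\<dots> = integral {0..s} (\<lambda>\<sigma>. M \<sigma> - s powr (-k) * (\<sigma> powr k * M \<sigma>))"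
      using s by (intro integral_cong) (simp add: powr_divide powr_minus field_simps)
    also have "\<dots> = A s - s powr (-k) * B s"
      unfolding A_def B_def
      by (subst integral_diff)
        (auto intro!: integrable_continuous_interval contM contkM integrable_on_mult_right)
    finally show ?thesis using y(2)[of s] s by (simp add: M_def mult.assoc)
  qed
  \<comment> \<open>This is \<open>s\<^sup>2\<close> times the derivative of \<open>y\<close>, in
    which the two terms with \<open>M s\<close> have cancelled.\<close>
  define R where "R s = 1 / l\<^sup>2 * (s powr (1 - k) * B s)" for s
  show thesis
  proof
    show "continuous_on UNIV y" by (rule y)
    show "y 0 = 1" using y(2)[of 0] by simp
    show "y s \<le> 1" if s: "s \<ge> 0" for s
    proof -
      have "integral {0..1} (\<lambda>\<tau>. (1 - \<tau> powr k) * clamped_source a (s * \<tau>) (y (s * \<tau>))) \<le> integral {0..1} (\<lambda>\<tau>::real. 0)"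
      proof (rule integral_le)
        show "(\<lambda>\<tau>. (1 - \<tau> powr k) * clamped_source a (s * \<tau>) (y (s * \<tau>))) integrable_on {0..1}"
          using k by (intro integrable_continuous_interval continuous_intros continuous_on_powr' continuous_on_clamped_source
             continuous_on_compose2[OF y(1)]) auto
        show "(1 - \<tau> powr k) * clamped_source a (s * \<tau>) (y (s * \<tau>)) \<le> 0" if "\<tau> \<in> {0..1}" for \<tau>
          using that k a clamped_source_nonpos[of a]
          by (intro mult_nonneg_nonpos) (auto simp: powr_le1)
      qed auto
      then show ?thesis using y(2)[OF s] s C by (simp add: mult_nonneg_nonpos)
    qed
    fix s :: real assume s: "s > 0"
    have powr_shift: "s powr (1 - k) = s powr (-k) * s" "s powr (-k - 1) = s powr (-k) / s"
        "s powr (- k) * s powr k = 1"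
      using s powr_mult_base[of s "-k"] powr_mult_base[of s "-k-1"]
      by (auto simp: field_simps simp flip: powr_add)
    have "((\<lambda>s. 1 + C * (A s - s powr (-k) * B s)) has_real_derivative
        C * (M s - ((- k) * s powr (- k - 1) * B s + s powr (- k) * (s powr k * M s)))) (at s)"
      using s by (auto intro!: derivative_eq_intros A' B')
    also have "C * (M s - ((- k) * s powr (- k - 1) * B s + s powr (- k) * (s powr k * M s)))
        = C * k * (s powr (- k - 1) * B s) + C * M s * (1 - s powr (- k) * s powr k)"
      by (simp add: algebra_simps)
    also have "\<dots> = R s / s\<^sup>2"
      unfolding R_def powr_shift using s k by (simp add: C_def power2_eq_square)
    finally show "(y has_real_derivative R s / s\<^sup>2) (at s)"
      by (rule has_field_derivative_transform_within_open[where S = "{0<..}"])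
        (use s in \<open>auto simp: yAB\<close>)
    have "(R has_real_derivative 1 / l\<^sup>2 * ((1 - k) * s powr (1 - k - 1) * B s + s powr (1 - k) * (s powr k * M s))) (at s)"
        unfolding R_def[abs_def]
      by (intro DERIV_cmult) (use s in \<open>auto intro!: derivative_eq_intros B'\<close>)
    also have "1 / l\<^sup>2 * ((1 - k) * s powr (1 - k - 1) * B s + s powr (1 - k) * (s powr k * M s))
        = (1 - k) * R s / s + s * M s / l\<^sup>2 * (s powr (- k) * s powr k)"
      unfolding R_def powr_shift using s l powr_shift(3) by (simp add: field_simps)
    finally show "(R has_real_derivative ((1 - k) * R s / s + s * clamped_source a s (y s) / l\<^sup>2)) (at s)"
      using powr_shift(3) by (simp add: M_def)
    have "norm (B s) \<le> integral {0..s} (\<lambda>\<sigma>. s powr k * (1 + a))"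
      unfolding B_def
    proof (rule integral_norm_bound_integral)
      show "norm (\<sigma> powr k * M \<sigma>) \<le> s powr k * (1 + a)" if "\<sigma> \<in> {0..s}" for \<sigma>
        using that k abs_clamped_source_le[OF a, of \<sigma> "y \<sigma>"] unfolding norm_mult
        by (intro mult_mono powr_mono2) (auto simp: M_def intro: powr_mono2)
    qed (auto intro!: integrable_continuous_interval contkM)
    then have "\<bar>B s\<bar> \<le> s powr k * (s * (1 + a))" using s by (simp add: mult_ac)
    then have "s powr (1 - k) * \<bar>B s\<bar> \<le> s powr (1 - k) * (s powr k * (s * (1 + a)))"
      by (intro mult_left_mono) auto
    also have "\<dots> = (s powr (-k) * s powr k) * ((1 + a) * s\<^sup>2)"
      unfolding powr_shift(1) by (simp add: power2_eq_square)
    also have "\<dots> = (1 + a) * s\<^sup>2" using powr_shift(3) by simp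
    finally show "\<bar>R s\<bar> \<le> (1 + a) / l\<^sup>2 * s\<^sup>2"
      using l by (simp add: R_def abs_mult divide_right_mono)
  qed
qed

text \<open>The profile read in \<open>z\<close> through \<open>s = exp (l * z)\<close>. As
  \<open>y\<close> tends to 1 and \<open>R\<close> is of order \<open>s\<^sup>2\<close>, the pair
  \<open>(\<Phi>, \<Psi>)\<close> behaves like \<open>s\<close> times the unstable eigenvector
  \<open>(1, l)\<close>.\<close>

lemma clamped_orbit_exists:
  assumes a: "a \<ge> 0" and c: "c \<ge> 0" and l: "l > 0" "l\<^sup>2 + c * l = a"
  obtains y \<Phi> \<Psi> where
    "continuous_on UNIV y" "y 0 = 1" "\<And>s. s \<ge> 0 \<Longrightarrow> y s \<le> 1"
    "\<And>z. \<Phi> z = exp (l * z) * y (exp (l * z))"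
    "\<And>z. (\<Phi> has_real_derivative \<Psi> z) (at z)"
    "\<And>z. (\<Psi> has_real_derivative (- c * \<Psi> z + a * \<Phi> z +
        (exp (l * z))\<^sup>2 * clamped_source a (exp (l * z)) (y (exp (l * z))))) (at z)"
    "((\<lambda>z. \<Psi> z / exp (l * z)) \<longlongrightarrow> l) at_bot"
proof -
  \<comment> \<open>The saddle has eigenvalues \<open>l\<close> and \<open>- c - l\<close>, and
    \<open>1 - k\<close> is the ratio of the second to the first.\<close>
  define k where "k = 2 + c / l"
  have k: "k > 0" using c l by (simp add: k_def add_pos_nonneg)
  obtain y R where y: "continuous_on UNIV y" "y 0 = 1" "\<And>s. s \<ge> 0 \<Longrightarrow> y s \<le> 1"
    and y': "\<And>s. s > 0 \<Longrightarrow> (y has_real_derivative R s / s\<^sup>2) (at s)"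
    and R': "\<And>s. s > 0 \<Longrightarrow> (R has_real_derivative ((1 - k) * R s / s + s * clamped_source a s (y s) / l\<^sup>2)) (at s)"
    and R: "\<And>s. s > 0 \<Longrightarrow> \<bar>R s\<bar> \<le> (1 + a) / l\<^sup>2 * s\<^sup>2"
    using clamped_profile_exists[OF a k, of l] l by (metis less_irrefl)
  let ?e = "\<lambda>z. exp (l * z)"
  have e': "(?e has_real_derivative l * ?e z) (at z)" for z
    by (auto intro!: derivative_eq_intros)
  have e0: "(?e \<longlongrightarrow> 0) at_bot" using l(1) by (rule tendsto_exp_mult_at_bot)
  define \<Phi> where "\<Phi> z = ?e z * y (?e z)" for z
  define \<Psi> where "\<Psi> z = l * (?e z * y (?e z) + R (?e z))" for z
  show thesis
  proof
    fix z
    show "\<Phi> z = ?e z * y (?e z)" by (simp add: \<Phi>_def)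
    have ye: "((\<lambda>z. y (?e z)) has_real_derivative R (?e z) / (?e z)\<^sup>2 * (l * ?e z)) (at z)"
      by (rule DERIV_chain2[OF y' e']) simp
    have Re: "((\<lambda>z. R (?e z)) has_real_derivative
        ((1 - k) * R (?e z) / ?e z + ?e z * clamped_source a (?e z) (y (?e z)) / l\<^sup>2) * (l * ?e z)) (at z)"
      by (rule DERIV_chain2[OF R' e']) simp
    have P: "((\<lambda>z. ?e z * y (?e z)) has_real_derivative \<Psi> z) (at z)"
      by (rule DERIV_cong[OF DERIV_mult[OF e' ye]])
        (simp add: \<Psi>_def power2_eq_square field_simps)
    then show "(\<Phi> has_real_derivative \<Psi> z) (at z)" by (simp add: \<Phi>_def[abs_def])
    let ?M = "clamped_source a (?e z) (y (?e z))"
    have "(\<Psi> has_real_derivative l * (\<Psi> z +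
        ((1 - k) * R (?e z) / ?e z + ?e z * ?M / l\<^sup>2) * (l * ?e z))) (at z)"
      unfolding \<Psi>_def[abs_def] by (intro DERIV_cmult DERIV_add Re P[unfolded \<Psi>_def])
    also have "l * (\<Psi> z + ((1 - k) * R (?e z) / ?e z + ?e z * ?M / l\<^sup>2) * (l * ?e z))
        = l * \<Psi> z + l\<^sup>2 * (1 - k) * R (?e z) + (?e z)\<^sup>2 * ?M"
      using l by (simp add: field_simps power2_eq_square)
    also have "l\<^sup>2 * (1 - k) = - l\<^sup>2 - c * l"
      using l by (simp add: k_def field_simps power2_eq_square)
    also have "l * \<Psi> z + (- l\<^sup>2 - c * l) * R (?e z) + (?e z)\<^sup>2 * ?M
        = - c * \<Psi> z + a * \<Phi> z + (?e z)\<^sup>2 * ?M"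
      by (simp add: \<Psi>_def \<Phi>_def power2_eq_square algebra_simps flip: l(2))
    finally show "(\<Psi> has_real_derivative (- c * \<Psi> z + a * \<Phi> z + (?e z)\<^sup>2 * ?M)) (at z)" .
  next
    have "((\<lambda>z. R (?e z) / ?e z) \<longlongrightarrow> 0) at_bot"
    proof (rule Lim_null_comparison)
      show "eventually (\<lambda>z. norm (R (?e z) / ?e z) \<le> (1 + a) / l\<^sup>2 * ?e z) at_bot"
        using R[of "?e z" for z] by (auto simp: abs_divide power2_eq_square divide_le_eq mult.assoc)
      show "((\<lambda>z. (1 + a) / l\<^sup>2 * ?e z) \<longlongrightarrow> 0) at_bot"
        by (rule tendsto_mult_right_zero[OF e0])
    qed
    moreover have "((\<lambda>z. y (?e z)) \<longlongrightarrow> 1) at_bot"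
      using isCont_tendsto_compose[OF _ e0, of y] y(1,2)
      by (simp add: continuous_on_eq_continuous_at)
    ultimately have "((\<lambda>z. l * (y (?e z) + R (?e z) / ?e z)) \<longlongrightarrow> l * (1 + 0)) at_bot"
      by (intro tendsto_intros)
    then show "((\<lambda>z. \<Psi> z / ?e z) \<longlongrightarrow> l) at_bot"
      by (simp add: \<Psi>_def field_simps)
  qed (use y in auto)
qed

section \<open>The connecting orbit\<close>

lemma antimono_bounded_below_tendsto_at_top:
  fixes f :: "real \<Rightarrow> real"
  assumes "antimono f" "\<And>x. f x \<ge> B"
  obtains l where "(f \<longlongrightarrow> l) at_top"
proof
  have bdd: "bdd_below (range f)" by (rule bdd_belowI2[of _ B]) (rule assms(2))
  show "(f \<longlongrightarrow> Inf (range f)) at_top"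
  proof (rule order_tendstoI)
    fix y assume "y < Inf (range f)"
    then show "eventually (\<lambda>x. y < f x) at_top"
      using cINF_lower[OF bdd] by (intro always_eventually) (auto intro: less_le_trans)
  next
    fix y assume "Inf (range f) < y"
    then obtain x where "f x < y" using cINF_less_iff[OF _ bdd] by auto
    then show "eventually (\<lambda>x. f x < y) at_top"
      using assms(1) unfolding eventually_at_top_linorder
      by (auto intro!: exI[of _ x] intro: le_less_trans dest: antimonoD)
  qed
qed

text \<open>The function \<open>G\<close> of the energy: the primitive of
  \<open>u * (1 - u) * (u - a)\<close> that vanishes at 0.\<close>

definition potential :: "real \<Rightarrow> real \<Rightarrow> real" where
  "potential a u = - a * u\<^sup>2 / 2 + (1 + a) * u ^ 3 / 3 - u ^ 4 / 4"

lemma potential_1: "potential a 1 = (1 - 2 * a) / 12"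
  by (simp add: potential_def field_simps)

lemma has_derivative_potential:
  "(potential a has_real_derivative u * (1 - u) * (u - a)) (at u)"
  unfolding potential_def[abs_def]
  by (auto intro!: derivative_eq_intros simp: algebra_simps power2_eq_square power3_eq_cube)

text \<open>Linear bounds at the two outer equilibria. They turn an upper bound on the energy by a
  negative number into distances of \<open>\<Phi>\<close> from 0 and from 1.\<close>

lemma potential_ge:
  assumes "0 \<le> u" "u \<le> 1" "0 < a" "a < 1/2"
  shows "potential a u \<ge> - u" "potential a 1 - potential a u \<le> 3/2 * (1 - u)"
proof -
  have p: "u ^ n \<le> u" if "n \<ge> 1" for n using assms that power_decreasing[of 1 n u] by simp
  have "a * u\<^sup>2 \<le> 1/2 * u" using assms p[of 2] by (intro mult_mono) auto
  moreover have "(1 + a) * u ^ 3 \<ge> 0" using assms by simp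
  ultimately show "potential a u \<ge> - u" using p[of 4] assms unfolding potential_def by linarith
  define b where "b = - a / 2 * (1 + u) + (1 + a) / 3 * (1 + u + u\<^sup>2) - (1 + u) * (1 + u\<^sup>2) / 4"
  have eq: "potential a 1 - potential a u = (1 - u) * b"
    by (simp add: potential_def b_def field_simps power2_eq_square power3_eq_cube power4_eq_xxxx)
  have "(1 + a) / 3 * (1 + u + u\<^sup>2) \<le> (3/2) / 3 * 3"
    using assms p[of 2] by (intro mult_mono) auto
  moreover have "a / 2 * (1 + u) \<ge> 0" "(1 + u) * (1 + u\<^sup>2) / 4 \<ge> 0" using assms by auto
  ultimately have "b \<le> 3/2" by (simp add: b_def)
  then show "potential a 1 - potential a u \<le> 3/2 * (1 - u)"
    unfolding eq using assms by (metis diff_ge_0_iff_ge mult.commute mult_left_mono)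
qed

text \<open>The factorisation of \<open>\<Phi>\<close> through \<open>y\<close> and the limit of
  \<open>\<Psi> z / exp (l * z)\<close> are passed on because they make the front position finite
  and the profile differentiable there.\<close>

lemma connecting_orbit_exists:
  assumes a: "0 < a" "a < 1/2" and c: "0 < c" "c\<^sup>2 < 4 * a * (1 - a)"
  obtains l y \<Phi> \<Psi> where "l > 0" "continuous_on UNIV y" "y 0 = 1"
    "\<And>z. \<Phi> z = exp (l * z) * y (exp (l * z))"
    "\<And>z. 0 < \<Phi> z" "\<And>z. \<Phi> z < 1"
    "((\<lambda>z. \<Psi> z / exp (l * z)) \<longlongrightarrow> l) at_bot"
    "connecting_orbit a c \<Phi> \<Psi>"
    "\<And>Z. \<exists>z>Z. \<Phi> z < a" "\<And>Z. \<exists>z>Z. \<Phi> z > a"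
proof -
  \<comment> \<open>The positive root of \<open>l\<^sup>2 + c * l = a\<close>.\<close>
  define l where "l = (sqrt (c\<^sup>2 + 4 * a) - c) / 2"
  have "c < sqrt (c\<^sup>2 + 4 * a)" using a c by (intro real_less_rsqrt) auto
  then have l: "l > 0" by (simp add: l_def)
  have "(sqrt (c\<^sup>2 + 4 * a))\<^sup>2 = c\<^sup>2 + 4 * a" using a by simp
  then have la: "l\<^sup>2 + c * l = a"
    unfolding l_def by (simp add: power2_eq_square field_simps)
  let ?e = "\<lambda>z. exp (l * z)"
  have e0: "(?e \<longlongrightarrow> 0) at_bot" using l by (rule tendsto_exp_mult_at_bot)
  obtain y \<Phi> \<Psi> where y: "continuous_on UNIV y" "y 0 = 1" "\<And>s. s \<ge> 0 \<Longrightarrow> y s \<le> 1"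
    and \<Phi>_eq: "\<And>z. \<Phi> z = ?e z * y (?e z)"
    and \<Phi>: "\<And>z. (\<Phi> has_real_derivative \<Psi> z) (at z)"
    and \<Psi>_clamped: "\<And>z. (\<Psi> has_real_derivative (- c * \<Psi> z + a * \<Phi> z +
        (?e z)\<^sup>2 * clamped_source a (?e z) (y (?e z)))) (at z)"
    and \<Psi>_lim: "((\<lambda>z. \<Psi> z / ?e z) \<longlongrightarrow> l) at_bot"
    using clamped_orbit_exists[of a c l] a c l la by auto
  have y_lim: "((\<lambda>z. y (?e z)) \<longlongrightarrow> 1) at_bot"
    using isCont_tendsto_compose[OF _ e0, of y] y(1,2)
    by (simp add: continuous_on_eq_continuous_at)
  have \<Phi>_bot: "(\<Phi> \<longlongrightarrow> 0) at_bot"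
    using tendsto_mult[OF e0 y_lim] by (simp add: \<Phi>_eq[abs_def])
  have \<Psi>_bot: "(\<Psi> \<longlongrightarrow> 0) at_bot"
    using tendsto_mult[OF \<Psi>_lim e0] by simp
  have \<Phi>_cont: "isCont \<Phi> z" for z using \<Phi> by (rule DERIV_isCont)
  define g where "g u = u * (1 - u) * (u - a)" for u
  \<comment> \<open>All clamps are inactive here: \<open>y\<close> lies between 0 and 1, and
    \<open>s * y = \<Phi>\<close> is at most 1.\<close>
  have \<Psi>_if: "(\<Psi> has_real_derivative (- c * \<Psi> z - g (\<Phi> z))) (at z)"
    if "0 \<le> \<Phi> z" "\<Phi> z \<le> 1" for z
  proof -
    have "0 \<le> y (?e z)" using that(1) by (simp add: \<Phi>_eq zero_le_mult_iff)
    then have K: "unit_clamp (y (?e z)) = y (?e z)" using y(3) by (simp add: unit_clamp_eq)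
    have "(?e z)\<^sup>2 * clamped_source a (?e z) (y (?e z)) = (\<Phi> z)\<^sup>2 * (\<Phi> z - (1 + a))"
      using that(2) unfolding clamped_source_def K \<Phi>_eq by (simp add: power_mult_distrib)
    then have "- c * \<Psi> z + a * \<Phi> z + (?e z)\<^sup>2 * clamped_source a (?e z) (y (?e z)) = - c * \<Psi> z - g (\<Phi> z)"
      by (simp add: g_def power2_eq_square algebra_simps)
    with \<Psi>_clamped[of z] show ?thesis by (simp only:)
  qed

  \<comment> \<open>The energy traps the orbit\<close>
  define E where "E z = (\<Psi> z)\<^sup>2 / 2 + potential a (\<Phi> z)" for z
  have E_if: "(E has_real_derivative (- c * (\<Psi> z)\<^sup>2)) (at z)" if "0 \<le> \<Phi> z" "\<Phi> z \<le> 1" for z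
    unfolding E_def[abs_def]
    by (auto intro!: derivative_eq_intros \<Psi>_if that DERIV_chain2[OF has_derivative_potential \<Phi>]
        simp: g_def power2_eq_square field_simps)
  have E'_le: "- c * (\<Psi> z)\<^sup>2 \<le> 0" for z using c by simp
  have "isCont (potential a) 0" using has_derivative_potential by (rule DERIV_isCont)
  then have "((\<lambda>z. potential a (\<Phi> z)) \<longlongrightarrow> 0) at_bot"
    using isCont_tendsto_compose[OF _ \<Phi>_bot] by (fastforce simp: potential_def)
  then have "(E \<longlongrightarrow> 0\<^sup>2 / 2 + 0) at_bot"
    unfolding E_def[abs_def] by (intro tendsto_intros \<Psi>_bot) auto
  then have E_bot: "(E \<longlongrightarrow> 0) at_bot" by simp
  \<comment> \<open>Only the past of \<open>z1\<close> is assumed to lie in the unit interval, so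
    that this can be applied at a first exit time.\<close>
  have E_neg: "E z1 < 0" if in01: "\<And>z. z \<le> z1 \<Longrightarrow> 0 \<le> \<Phi> z \<and> \<Phi> z \<le> 1" for z1
  proof -
    have anti: "E z' \<le> E z" if "z \<le> z'" "z' \<le> z1" for z z'
      by (rule DERIV_nonpos_imp_nonincreasing[OF that(1)])
        (use E_if in01 that E'_le order_trans in blast)
    have E_le: "E z \<le> 0" if "z \<le> z1" for z
      by (rule tendsto_lowerbound[OF E_bot])
        (use anti that in \<open>auto simp: eventually_at_bot_linorder\<close>)
    \<comment> \<open>Strictness: far to the left \<open>\<Psi>\<close> is nonzero, so the energy,
      which is at most 0, drops strictly somewhere before \<open>z1\<close>.\<close>
    have "eventually (\<lambda>z. \<Psi> z / ?e z > 0 \<and> z < z1) at_bot"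
      by (intro eventually_conj order_tendstoD(1)[OF \<Psi>_lim l] eventually_gt_at_bot)
    from eventually_happens'[OF _ this] obtain z where z: "\<Psi> z \<noteq> 0" "z < z1"
      by (metis div_0 less_irrefl trivial_limit_at_bot_linorder)
    have "- c * (\<Psi> z)\<^sup>2 < 0" using z c by simp
    from DERIV_neg_dec_right[OF E_if this] in01[of z] z(2)
    obtain d where d: "d > 0" "\<And>h. 0 < h \<Longrightarrow> h < d \<Longrightarrow> E (z + h) < E z" by auto
    define h where "h = min (d / 2) (z1 - z)"
    have h: "0 < h" "h < d" "z + h \<le> z1" using d(1) z(2) by (auto simp: h_def min_def)
    have "E z1 \<le> E (z + h)" using anti[OF h(3)] by simp
    also have "\<dots> < E z" using d(2) h by simp
    also have "\<dots> \<le> 0" using E_le z(2) by simp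
    finally show ?thesis .
  qed
  have \<Phi>_01: "\<Phi> z \<in> {0<..<1}" for z
  proof (rule ccontr)
    assume out: "\<Phi> z \<notin> {0<..<1}"
    \<comment> \<open>The times at which the orbit is outside the open strip. This set is closed and
      bounded below, so its infimum is a first exit time.\<close>
    define S where "S = \<Phi> -` (- {0<..<1})"
    have "eventually (\<lambda>z. y (?e z) > 0 \<and> \<Phi> z < 1) at_bot"
      using order_tendstoD(1)[OF y_lim, of 0] order_tendstoD(2)[OF \<Phi>_bot, of 1] eventually_conj by force
    then obtain N where N: "\<And>z. z \<le> N \<Longrightarrow> y (?e z) > 0 \<and> \<Phi> z < 1"
      by (auto simp: eventually_at_bot_linorder)
    have NS: "N \<le> z" if "z \<in> S" for z
    proof (rule ccontr)
      assume "\<not> N \<le> z"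
      then have "0 < \<Phi> z" "\<Phi> z < 1" using N[of z] by (auto simp: \<Phi>_eq[of z])
      then show False using that by (simp add: S_def)
    qed
    have S: "closed S" "S \<noteq> {}"
      using out \<Phi>_cont by (auto simp: S_def intro!: continuous_closed_vimage)
    have bdd: "bdd_below S" by (rule bdd_belowI[OF NS])
    define z1 where "z1 = Inf S"
    have z1: "z1 \<in> S" unfolding z1_def by (rule closed_contains_Inf[OF S(2) bdd S(1)])
    have below: "0 < \<Phi> z \<and> \<Phi> z < 1" if "z < z1" for z
      using cInf_lower[OF _ bdd, of z] that by (auto simp: z1_def S_def)
    have left: "(\<Phi> \<longlongrightarrow> \<Phi> z1) (at_left z1)"
      using \<Phi>_cont[of z1] by (simp add: isCont_def filterlim_at_split)
    have ev: "eventually (\<lambda>z. 0 < \<Phi> z \<and> \<Phi> z < 1) (at_left z1)"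
      by (auto simp: eventually_at_filter below)
    \<comment> \<open>By continuity from the left the exit happens at height 0 or 1, where the
      potential is nonnegative; this contradicts the negative energy.\<close>
    have "0 \<le> \<Phi> z1" "\<Phi> z1 \<le> 1"
      by (rule tendsto_lowerbound[OF left] tendsto_upperbound[OF left],
          rule eventually_mono[OF ev], simp, simp)+
    moreover from this have "E z1 < 0"
      using below by (intro E_neg) (metis less_eq_real_def)
    moreover have "potential a 0 = 0" "potential a 1 > 0"
      using a unfolding potential_1 by (simp_all add: potential_def)
    moreover have "\<Phi> z1 \<le> 0 \<or> \<Phi> z1 \<ge> 1" using z1 by (auto simp: S_def)
    moreover have "(\<Psi> z1)\<^sup>2 / 2 \<ge> 0" by simp
    ultimately show False unfolding E_def by (smt (verit))
  qed
  have \<Phi>0: "0 < \<Phi> z" and \<Phi>1: "\<Phi> z < 1" for z using \<Phi>_01[of z] by auto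
  have \<Psi>: "(\<Psi> has_real_derivative (- c * \<Psi> z - g (\<Phi> z))) (at z)" for z
    using \<Psi>_if \<Phi>0 \<Phi>1 less_imp_le by blast
  have E: "(E has_real_derivative (- c * (\<Psi> z)\<^sup>2)) (at z)" for z
    using E_if \<Phi>0 \<Phi>1 less_imp_le by blast
  have E0: "E z < 0" for z by (intro E_neg) (use \<Phi>0 \<Phi>1 less_imp_le in blast)
  have E_anti: "E z' \<le> E z" if "z \<le> z'" for z z'
    by (rule DERIV_nonpos_imp_nonincreasing[OF that]) (use E E'_le in blast)
  have G: "potential a (\<Phi> z) \<ge> - \<Phi> z" "potential a 1 - potential a (\<Phi> z) \<le> 3/2 * (1 - \<Phi> z)" for z
    using potential_ge \<Phi>0 \<Phi>1 a less_imp_le by blast+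

  \<comment> \<open>Convergence to the inner equilibrium\<close>
  have "E z \<ge> -1" for z
    using G(1)[of z] \<Phi>1[of z] zero_le_power2[of "\<Psi> z"] unfolding E_def by linarith
  then obtain L where L: "(E \<longlongrightarrow> L) at_top"
    using antimono_bounded_below_tendsto_at_top[of E "-1"] E_anti by (metis antimonoI)
  have \<Psi>_bd: "\<bar>\<Psi> z\<bar> \<le> 2" for z
  proof -
    have "(\<Psi> z)\<^sup>2 \<le> 2\<^sup>2"
      using E0[of z] G(1)[of z] \<Phi>1[of z] unfolding E_def by simp
    then show ?thesis using abs_le_square_iff[of "\<Psi> z" 2] by simp
  qed
  have g_bd: "\<bar>g (\<Phi> z)\<bar> \<le> 1" for z
  proof -
    have "\<bar>\<Phi> z\<bar> * \<bar>1 - \<Phi> z\<bar> * \<bar>\<Phi> z - a\<bar> \<le> 1 * 1 * 1"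
      using \<Phi>0[of z] \<Phi>1[of z] a by (intro mult_mono) auto
    then show ?thesis by (simp add: g_def abs_mult)
  qed
  define \<Psi>' where "\<Psi>' z = - c * \<Psi> z - g (\<Phi> z)" for z
  have \<Psi>'_bd: "\<bar>\<Psi>' z\<bar> \<le> 2 * c + 1" for z
  proof -
    have "\<bar>c * \<Psi> z\<bar> \<le> c * 2" using \<Psi>_bd[of z] c by (simp add: abs_mult)
    then show ?thesis using g_bd[of z] unfolding \<Psi>'_def by linarith
  qed
  \<comment> \<open>The energy converges and its second derivative is bounded, so its derivative
    \<open>- c * (\<Psi> z)\<^sup>2\<close> tends to 0.\<close>
  have \<Psi>_top: "(\<Psi> \<longlongrightarrow> 0) at_top"
  proof -
    have "((\<lambda>z. - c * (\<Psi> z)\<^sup>2) \<longlongrightarrow> 0) at_top"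
    proof (rule derivative_tendsto_0_at_top[OF L E])
      show "((\<lambda>z. - c * (\<Psi> z)\<^sup>2) has_real_derivative (- c * (2 * \<Psi> z * \<Psi>' z))) (at z)" for z
        unfolding \<Psi>'_def by (auto intro!: derivative_eq_intros \<Psi> simp: algebra_simps)
      have bd: "\<bar>\<Psi> z\<bar> * \<bar>\<Psi>' z\<bar> \<le> 2 * (2 * c + 1)" for z
        using \<Psi>_bd \<Psi>'_bd c by (intro mult_mono) auto
      show "\<bar>- c * (2 * \<Psi> z * \<Psi>' z)\<bar> \<le> c * (2 * (2 * (2 * c + 1)))" for z
        using bd[of z] c by (simp add: abs_mult)
    qed
    from tendsto_mult[OF tendsto_const[of "- (1 / c)"] this]
    have "((\<lambda>z. (\<Psi> z)\<^sup>2) \<longlongrightarrow> 0) at_top" using c by simp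
    from tendsto_real_sqrt[OF this] show ?thesis by (simp add: tendsto_rabs_zero_iff)
  qed
  have \<Psi>'_top: "(\<Psi>' \<longlongrightarrow> 0) at_top"
  proof (rule derivative_tendsto_0_at_top[OF \<Psi>_top])
    show "(\<Psi> has_real_derivative \<Psi>' z) (at z)" for z using \<Psi> by (simp add: \<Psi>'_def)
    \<comment> \<open>The derivative of \<open>g\<close> at \<open>\<Phi> z\<close>.\<close>
    define b where "b z = - a + 2 * (1 + a) * \<Phi> z - 3 * (\<Phi> z)\<^sup>2" for z
    show "(\<Psi>' has_real_derivative (- c * \<Psi>' z - b z * \<Psi> z)) (at z)" for z
      unfolding \<Psi>'_def[abs_def] g_def b_def using \<Psi>[of z]
      by (auto intro!: derivative_eq_intros \<Phi> simp: g_def algebra_simps power2_eq_square)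
    show "\<bar>- c * \<Psi>' z - b z * \<Psi> z\<bar> \<le> c * (2 * c + 1) + 7 * 2" for z
    proof -
      have "0 < (1 + a) * \<Phi> z" using \<Phi>0[of z] a by simp
      moreover have "(1 + a) * \<Phi> z \<le> 3/2 * 1"
        using \<Phi>0[of z] \<Phi>1[of z] a by (intro mult_mono) auto
      moreover have "0 \<le> (\<Phi> z)\<^sup>2" "(\<Phi> z)\<^sup>2 \<le> 1"
        using \<Phi>0[of z] \<Phi>1[of z] by (auto simp: power_le_one)
      moreover have "b z = - a + 2 * ((1 + a) * \<Phi> z) - 3 * (\<Phi> z)\<^sup>2" by (simp add: b_def)
      ultimately have "\<bar>b z\<bar> \<le> 7" using a by linarith
      then have "\<bar>b z * \<Psi> z\<bar> \<le> 7 * 2"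
        unfolding abs_mult using \<Psi>_bd by (intro mult_mono) auto
      moreover have "\<bar>c * \<Psi>' z\<bar> \<le> c * (2 * c + 1)"
        using \<Psi>'_bd[of z] c by (simp add: abs_mult)
      ultimately show ?thesis by linarith
    qed
  qed
  have \<Phi>_top: "(\<Phi> \<longlongrightarrow> a) at_top"
  proof -
    \<comment> \<open>From time 0 on the energy is at most \<open>- \<epsilon>\<close>, which keeps
      \<open>\<Phi>\<close> away from 0 and 1. Since \<open>g (\<Phi> z)\<close> tends to 0, its
      remaining factor \<open>\<Phi> z - a\<close> must do so.\<close>
    define \<epsilon> where "\<epsilon> = - E 0"
    have \<epsilon>: "\<epsilon> > 0" using E0[of 0] by (simp add: \<epsilon>_def)
    have far: "\<epsilon> \<le> \<Phi> z" "2/3 * \<epsilon> \<le> 1 - \<Phi> z" if "z \<ge> 0" for z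
    proof -
      have "potential a (\<Phi> z) \<le> - \<epsilon>"
        using E_anti[OF that] zero_le_power2[of "\<Psi> z"] unfolding \<epsilon>_def E_def by linarith
      moreover have "potential a 1 > 0" using a by (simp add: potential_1)
      ultimately have "\<epsilon> \<le> \<Phi> z" "\<epsilon> \<le> 3/2 * (1 - \<Phi> z)" using G[of z] by linarith+
      then show "\<epsilon> \<le> \<Phi> z" "2/3 * \<epsilon> \<le> 1 - \<Phi> z" by simp_all
    qed
    have "((\<lambda>z. \<Phi> z - a) \<longlongrightarrow> 0) at_top"
    proof (rule Lim_null_comparison)
      have "((\<lambda>z. \<bar>- c * \<Psi> z - \<Psi>' z\<bar> / (\<epsilon> * (2/3 * \<epsilon>))) \<longlongrightarrow> \<bar>- c * 0 - 0\<bar> / (\<epsilon> * (2/3 * \<epsilon>))) at_top"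
        using \<epsilon> by (intro tendsto_intros \<Psi>_top \<Psi>'_top) auto
      then show "((\<lambda>z. \<bar>- c * \<Psi> z - \<Psi>' z\<bar> / (\<epsilon> * (2/3 * \<epsilon>))) \<longlongrightarrow> 0) at_top" by simp
      have "norm (\<Phi> z - a) \<le> \<bar>- c * \<Psi> z - \<Psi>' z\<bar> / (\<epsilon> * (2/3 * \<epsilon>))" if "z \<ge> 0" for z
      proof -
        have "\<bar>\<Phi> z - a\<bar> * (\<epsilon> * (2/3 * \<epsilon>)) \<le> \<bar>\<Phi> z - a\<bar> * (\<Phi> z * (1 - \<Phi> z))"
          using far[OF that] \<epsilon> \<Phi>0[of z] by (intro mult_left_mono mult_mono) auto
        also have "\<dots> = \<bar>- c * \<Psi> z - \<Psi>' z\<bar>"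
          using \<Phi>0[of z] \<Phi>1[of z] by (simp add: \<Psi>'_def g_def abs_mult mult_ac)
        finally show ?thesis using \<epsilon> by (simp add: le_divide_eq)
      qed
      then show "eventually (\<lambda>z. norm (\<Phi> z - a) \<le> \<bar>- c * \<Psi> z - \<Psi>' z\<bar> / (\<epsilon> * (2/3 * \<epsilon>))) at_top"
        unfolding eventually_at_top_linorder by blast
    qed
    then show ?thesis by (simp add: LIM_zero_iff)
  qed

  \<comment> \<open>Oscillation about the inner equilibrium\<close>
  define q where "q z = \<Phi> z * (1 - \<Phi> z)" for z
  \<comment> \<open>Half of the gap between the limit \<open>a * (1 - a)\<close> of \<open>q\<close>
    and the critical value \<open>c\<^sup>2 / 4\<close>.\<close>
  define \<delta> where "\<delta> = (a * (1 - a) - c\<^sup>2 / 4) / 2"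
  have \<delta>: "\<delta> > 0" using c by (simp add: \<delta>_def)
  have "(q \<longlongrightarrow> a * (1 - a)) at_top"
    unfolding q_def[abs_def] by (intro tendsto_intros \<Phi>_top)
  then have "eventually (\<lambda>z. c\<^sup>2 / 4 + \<delta> < q z) at_top"
    by (rule order_tendstoD(1)) (use \<delta> in \<open>simp add: \<delta>_def field_simps\<close>)
  then have q: "eventually (\<lambda>z. c\<^sup>2 / 4 + \<delta> \<le> q z) at_top"
    by (rule eventually_mono) simp
  have Q: "\<bar>q z\<bar> \<le> 1" for z
    using \<Phi>0[of z] \<Phi>1[of z] by (simp add: q_def abs_mult mult_le_one)
  have ne: "\<exists>z\<le>Z. \<Phi> z \<noteq> a" for Z
  proof -
    have "eventually (\<lambda>z. \<Phi> z < a) at_bot" using order_tendstoD(2)[OF \<Phi>_bot] a by simp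
    then obtain N where "\<And>z. z \<le> N \<Longrightarrow> \<Phi> z < a" by (auto simp: eventually_at_bot_linorder)
    then show ?thesis by (intro exI[of _ "min N Z"]) (metis less_irrefl min.cobounded1 min.cobounded2)
  qed
  have \<eta>: "((\<lambda>z. \<Phi> z - a) has_real_derivative \<Psi> z) (at z)" for z
    by (auto intro!: derivative_eq_intros \<Phi>)
  have \<Psi>q: "(\<Psi> has_real_derivative (- c * \<Psi> z - q z * (\<Phi> z - a))) (at z)" for z
    using \<Psi>[of z] by (simp add: q_def g_def)
  have "\<exists>z>Z. \<Phi> z - a < 0" for Z
    by (rule damped_oscillator_neg_arbitrarily_late[OF \<eta> \<Psi>q Q q \<delta>]) (use ne in simp)
  moreover have "\<exists>z>Z. - (\<Phi> z - a) < 0" for Z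
  proof (rule damped_oscillator_neg_arbitrarily_late[OF DERIV_minus[OF \<eta>] _ Q q \<delta>])
    show "((\<lambda>z. - \<Psi> z) has_real_derivative - c * - \<Psi> z - q z * - (\<Phi> z - a)) (at z)" for z
      using DERIV_minus[OF \<Psi>q, of z] by (simp add: algebra_simps)
  qed (use ne in \<open>simp add: eq_commute[of a]\<close>)
  moreover have "connecting_orbit a c \<Phi> \<Psi>"
    unfolding connecting_orbit_def using \<Phi> \<Psi> \<Phi>_top \<Psi>_top \<Phi>_bot \<Psi>_bot
    by (auto simp: g_def intro!: tendsto_Pair)
  ultimately show thesis
    using that[of l y \<Phi> \<Psi>] l y \<Phi>_eq \<Phi>0 \<Phi>1 \<Psi>_lim by simp
qed

section \<open>The travelling wave\<close>

text \<open>Here \<open>w'\<close> is the flux, the derivative of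
  \<open>v powr (m + 1) / (m + 1)\<close>, and the last pointwise hypothesis on it is the wave
  equation. It splits the integrand into a \<open>t\<close>-derivative and an
  \<open>x\<close>-derivative, whose boundary values are the right-hand side.\<close>

lemma travelling_wave_weak_identity:
  fixes v v' w' f :: "real \<Rightarrow> real"
  assumes m: "m + 1 \<noteq> 0"
    and v: "\<And>x. (v has_real_derivative v' x) (at x)" and cont': "continuous_on UNIV v'"
    and w: "\<And>x. ((\<lambda>x. v x powr (m + 1)) has_real_derivative (m + 1) * w' x) (at x)"
    and w': "\<And>x. (w' has_real_derivative (- c * v' x - f (v x))) (at x)"
    and contf: "continuous_on UNIV (\<lambda>x. f (v x))"
    and r: "r > 0" and T: "T > 0"
    and C21: "C21_strip T \<phi> \<phi>t \<phi>x \<phi>xx"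
    and boundary: "\<And>t. t \<in> {0..T} \<Longrightarrow> \<phi> t r = 0 \<and> \<phi> t (-r) = 0"
  shows "weak_identity m f v (\<lambda>t x. v (x - c * t)) r T \<phi> \<phi>t \<phi>x \<phi>xx"
proof -
  define d where "d = 1 / (m + 1)"
  define W where "W x = d * v x powr (m + 1)" for x
  have W: "(W has_real_derivative w' x) (at x)" for x
    unfolding W_def[abs_def] using DERIV_cmult[OF w, of d x] m by (simp add: d_def)
  have \<phi>t: "((\<lambda>s. \<phi> s x) has_real_derivative \<phi>t t x) (at t within {0..T})"
    and \<phi>x: "(\<phi> t has_real_derivative \<phi>x t x) (at x)"
    and \<phi>xx: "(\<phi>x t has_real_derivative \<phi>xx t x) (at x)" if "t \<in> {0..T}" for t x
    using C21 that by (auto simp: C21_strip_def)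
  have c0: "continuous_on ({0..T} \<times> UNIV) (\<lambda>(t, x). \<phi> t x)"
    "continuous_on ({0..T} \<times> UNIV) (\<lambda>(t, x). \<phi>t t x)"
    "continuous_on ({0..T} \<times> UNIV) (\<lambda>(t, x). \<phi>x t x)"
    "continuous_on ({0..T} \<times> UNIV) (\<lambda>(t, x). \<phi>xx t x)"
    using C21 by (auto simp: C21_strip_def)
  note cont2 = this[THEN continuous_on_compose2, OF continuous_on_Pair, simplified]
  have contv: "continuous_on UNIV v" and contW: "continuous_on UNIV W"
    using v W by (meson DERIV_continuous_on has_field_derivative_at_within)+
  note cont1 = contv[THEN continuous_on_compose2] cont'[THEN continuous_on_compose2]
     contW[THEN continuous_on_compose2] contf[THEN continuous_on_compose2]
  \<comment> \<open>The \<open>t\<close>-derivative of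
    \<open>v (x - c * t) * \<phi> t x\<close>.\<close>
  define D where "D t x = v (x - c * t) * \<phi>t t x - c * v' (x - c * t) * \<phi> t x" for t x
  define b where "b t = W (r - c * t) * \<phi>x t r - W (- r - c * t) * \<phi>x t (- r)" for t
  have D_cont: "continuous_on (cbox (0, -r) (T, r)) (\<lambda>(t, x). D t x)"
    unfolding D_def split_beta
    by (intro continuous_intros cont1 cont2) (auto simp: cbox_Pair_eq)
  have inner: "integral {-r..r} (\<lambda>x. v (x - c * t) * \<phi>t t x + d * v (x - c * t) powr (m + 1) * \<phi>xx t x + f (v (x - c * t)) * \<phi> t x)
      = integral {-r..r} (D t) + b t" if t: "t \<in> {0..T}" for t
  proof -
    \<comment> \<open>Its \<open>x\<close>-derivative is the rest of the integrand. At
      \<open>x = r\<close> and \<open>x = - r\<close> only the first term survives, because the test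
      function vanishes there.\<close>
    define g where "g x = W (x - c * t) * \<phi>x t x - w' (x - c * t) * \<phi> t x" for x
    define g' where "g' x = W (x - c * t) * \<phi>xx t x + (c * v' (x - c * t) + f (v (x - c * t))) * \<phi> t x" for x
    have "(g has_real_derivative g' x) (at x)" for x
      unfolding g_def[abs_def] g'_def
      by (auto intro!: derivative_eq_intros DERIV_chain2[OF W] DERIV_chain2[OF w'] \<phi>x \<phi>xx t simp: algebra_simps)
    then have "(g' has_integral (g r - g (- r))) {-r..r}"
      using r by (intro fundamental_theorem_of_calculus)
        (auto simp flip: has_real_derivative_iff_has_vector_derivative intro: has_field_derivative_at_within)
    also have "g r - g (- r) = b t" using boundary[OF t] by (simp add: g_def b_def)
    finally have g': "(g' has_integral b t) {-r..r}" .
    have "D t integrable_on {-r..r}"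
      unfolding D_def using t by (intro integrable_continuous_interval continuous_intros cont1 cont2) auto
    then have "(D t has_integral integral {-r..r} (D t)) {-r..r}" by (rule integrable_integral)
    from has_integral_add[OF this g']
    have "((\<lambda>x. v (x - c * t) * \<phi>t t x + d * v (x - c * t) powr (m + 1) * \<phi>xx t x + f (v (x - c * t)) * \<phi> t x)
      has_integral integral {-r..r} (D t) + b t) {-r..r}"
      by (rule has_integral_eq[rotated]) (simp add: D_def g'_def W_def algebra_simps)
    then show ?thesis by (rule integral_unique)
  qed
  have outer: "integral {0..T} (\<lambda>t. D t x) = v (x - c * T) * \<phi> T x - v x * \<phi> 0 x" for x
  proof -
    have "((\<lambda>t. v (x - c * t) * \<phi> t x) has_real_derivative D t x) (at t within {0..T})"
      if "t \<in> {0..T}" for t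
      unfolding D_def
      by (rule derivative_eq_intros DERIV_chain2[OF v] \<phi>t that refl | simp)+
    then have "((\<lambda>t. D t x) has_integral (v (x - c * T) * \<phi> T x - v (x - c * 0) * \<phi> 0 x)) {0..T}"
      using T by (intro fundamental_theorem_of_calculus)
        (auto simp flip: has_real_derivative_iff_has_vector_derivative)
    then show ?thesis by (simp add: integral_unique)
  qed
  have "integral {0..T} (\<lambda>t. integral {-r..r} (\<lambda>x. v (x - c * t) * \<phi>t t x + d * v (x - c * t) powr (m + 1) * \<phi>xx t x + f (v (x - c * t)) * \<phi> t x))
     = integral {0..T} (\<lambda>t. integral {-r..r} (D t) + b t)"
    by (intro integral_cong inner)
  also have "\<dots> = integral {0..T} (\<lambda>t. integral {-r..r} (D t)) + integral {0..T} b"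
  proof (rule integral_add)
    have "continuous_on ({0..T} \<times> cbox (-r) r) (\<lambda>(t, x). D t x)"
      using D_cont by (simp add: cbox_Pair_eq)
    from integral_continuous_on_param[OF this]
    show "(\<lambda>t. integral {-r..r} (D t)) integrable_on {0..T}"
      by (intro integrable_continuous_interval) simp
    show "b integrable_on {0..T}"
      unfolding b_def by (intro integrable_continuous_interval continuous_intros cont1 cont2) auto
  qed
  \<comment> \<open>Exchanging the order lets the time integral be evaluated first.\<close>
  also have "integral {0..T} (\<lambda>t. integral {-r..r} (D t)) = integral {-r..r} (\<lambda>x. integral {0..T} (\<lambda>t. D t x))"
    using integral_swap_continuous[OF D_cont] by simp
  also have "\<dots> = integral {-r..r} (\<lambda>x. v (x - c * T) * \<phi> T x - v x * \<phi> 0 x)"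
    by (simp add: outer)
  also have "integral {0..T} b = d * integral {0..T} (\<lambda>t. v (r - c * t) powr (m + 1) * \<phi>x t r - v (- r - c * t) powr (m + 1) * \<phi>x t (- r))"
    unfolding b_def W_def by (simp flip: integral_mult_right add: algebra_simps)
  finally show ?thesis
    unfolding weak_identity_def Let_def d_def by simp
qed

text \<open>At the junction l'Hopital's rule converts the limit of \<open>f'\<close> into that of
  the right difference quotient. This glues profile, power and flux to zero at the front.\<close>

lemma has_real_derivative_extend_by_0:
  fixes f f' :: "real \<Rightarrow> real"
  assumes f': "\<And>x. x > 0 \<Longrightarrow> (f has_real_derivative f' x) (at x)"
    and lim: "(f \<longlongrightarrow> 0) (at_right 0)" "(f' \<longlongrightarrow> 0) (at_right 0)"
  shows "((\<lambda>x. if x > 0 then f x else 0) has_real_derivative (if x > 0 then f' x else 0)) (at x)"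
proof (cases x "0 :: real" rule: linorder_cases)
  case less
  have "((\<lambda>x. if x > 0 then f x else 0) has_real_derivative 0) (at x)"
    by (rule has_field_derivative_transform_within_open[OF DERIV_const, where S = "{..<0}"])
      (use less in auto)
  then show ?thesis using less by simp
next
  case greater
  have "((\<lambda>x. if x > 0 then f x else 0) has_real_derivative f' x) (at x)"
    by (rule has_field_derivative_transform_within_open[OF f'[OF greater], where S = "{0<..}"])
      (use greater in auto)
  then show ?thesis using greater by simp
next
  case equal
  have ev: "eventually (\<lambda>y. y > (0::real)) (at_right 0)" by (simp add: eventually_at_filter)
  have "((\<lambda>y. f y / y) \<longlongrightarrow> 0) (at_right 0)"
    by (rule lhopital_right[where g' = "\<lambda>_. 1" and f' = f'])
      (use lim ev in \<open>auto intro: tendsto_ident_at elim: eventually_mono dest: f'\<close>)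
  then have "((\<lambda>y. (if y > 0 then f y else 0) / y) \<longlongrightarrow> 0) (at_right 0)"
    by (rule Lim_transform_eventually) (use ev in \<open>auto elim: eventually_mono\<close>)
  moreover have "((\<lambda>y. (if y > 0 then f y else 0) / y) \<longlongrightarrow> 0) (at_left 0)"
    by (rule tendsto_eventually) (simp add: eventually_at_filter)
  ultimately show ?thesis using equal
    by (simp add: has_field_derivative_iff filterlim_at_split)
qed

lemma continuous_on_extend_by_0:
  fixes f :: "real \<Rightarrow> real"
  assumes f: "continuous_on {0<..} f" and lim: "(f \<longlongrightarrow> 0) (at_right 0)"
  shows "continuous_on UNIV (\<lambda>x. if x > 0 then f x else 0)"
proof -
  have "isCont (\<lambda>x. if x > 0 then f x else 0) x" for x
  proof (cases x "0 :: real" rule: linorder_cases)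
    case less
    show ?thesis
      by (rule isCont_cong[THEN iffD2, OF _ continuous_const])
        (use less in \<open>auto simp: eventually_nhds intro!: exI[of _ "{..<0}"]\<close>)
  next
    case greater
    then have "isCont f x" using f by (simp add: continuous_on_eq_continuous_at)
    then show ?thesis
      by (rule isCont_cong[THEN iffD2, rotated])
        (use greater in \<open>auto simp: eventually_nhds intro!: exI[of _ "{0<..}"]\<close>)
  next
    case equal
    have "((\<lambda>y. if y > 0 then f y else 0) \<longlongrightarrow> 0) (at_right 0)"
      by (rule Lim_transform_eventually[OF lim]) (simp add: eventually_at_filter)
    moreover have "((\<lambda>y. if y > 0 then f y else 0) \<longlongrightarrow> 0) (at_left 0)"
      by (rule tendsto_eventually) (simp add: eventually_at_filter)
    ultimately show ?thesis using equal by (simp add: isCont_def filterlim_at_split)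
  qed
  then show ?thesis by (simp add: continuous_at_imp_continuous_on)
qed

lemma changes_sign_infinitely_oftenI:
  assumes neg: "\<And>X. \<exists>x>X. g x < 0" and pos: "\<And>X. \<exists>x>X. g x > 0"
  shows "changes_sign_infinitely_often g"
proof -
  \<comment> \<open>Parity prescribes the sign, so consecutive values have opposite signs; the bound
    by \<open>n\<close> makes the sequence diverge.\<close>
  define P where "P n x \<longleftrightarrow> real n \<le> x \<and> (if even n then g x < 0 else g x > 0)" for n x
  have "\<exists>y. P n y \<and> X < y" for n X
  proof -
    obtain x x' where "x > max X (real n)" "g x < 0" "x' > max X (real n)" "g x' > 0"
      using neg pos by blast
    then show ?thesis unfolding P_def
      by (intro exI[of _ "if even n then x else x'"]) auto
  qed
  then have "\<exists>s. \<forall>n. P n (s n) \<and> s n < s (Suc n)"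
    by (intro dependent_nat_choice) blast+
  then obtain s where s: "\<And>n. P n (s n)" "\<And>n. s n < s (Suc n)" by blast
  have "filterlim s at_top sequentially"
    by (rule filterlim_at_top_mono[OF filterlim_real_sequentially])
      (use s(1) in \<open>auto simp: P_def\<close>)
  moreover have "g (s n) * g (s (Suc n)) < 0" for n
    using s(1)[of n] s(1)[of "Suc n"] by (auto simp: P_def mult_less_0_iff split: if_splits)
  ultimately show ?thesis
    unfolding changes_sign_infinitely_often_def using s(2) by (blast intro: strict_monoI_Suc)
qed

text \<open>Meant for \<open>F\<close> the physical coordinate as a function of \<open>z\<close>:
  then \<open>Z\<close> is the desingularized variable, and its two limits carry limits in
  \<open>z\<close> over to infinity and to the front.\<close>

lemma inverse_of_increasing_onto_positive:
  fixes F h :: "real \<Rightarrow> real"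
  assumes F: "\<And>z. (F has_real_derivative h z) (at z)" and h: "\<And>z. h z > 0"
    and bot: "(F \<longlongrightarrow> 0) at_bot" and top: "filterlim F at_top at_top"
  obtains Z where "bij_betw Z {0<..} UNIV" "\<And>x. x > 0 \<Longrightarrow> F (Z x) = x" "\<And>z. Z (F z) = z" "\<And>z. F z > 0"
    "\<And>x. x > 0 \<Longrightarrow> (Z has_real_derivative inverse (h (Z x))) (at x)"
    "filterlim Z at_top at_top" "filterlim Z at_bot (at_right 0)"
proof -
  have less: "F x < F y" if "x < y" for x y
    by (rule DERIV_pos_imp_increasing[OF that]) (use F h in blast)
  then have less_iff: "F x < F y \<longleftrightarrow> x < y" and inj: "inj F" for x y
    by (metis less_asym linorder_neqE_linordered_idom injI less_irrefl)+
  have le_iff: "F x \<le> F y \<longleftrightarrow> x \<le> y" for x y using less_iff[of y x] by (simp add: not_less[symmetric])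
  have cont: "isCont F z" for z using F by (rule DERIV_isCont)
  have pos: "F z > 0" for z
  proof -
    \<comment> \<open>The limit gives only a weak inequality; one step to the left makes it
      strict.\<close>
    have "F (z - 1) \<ge> 0"
      by (rule tendsto_upperbound[OF bot])
        (auto simp: eventually_at_bot_linorder le_iff)
    then show ?thesis using less[of "z - 1" z] by simp
  qed
  have onto: "\<exists>z. F z = x" if x: "x > 0" for x
  proof -
    have "eventually (\<lambda>z. F z < x) at_bot" by (rule order_tendstoD(2)[OF bot x])
    then obtain z0 where "F z0 < x" by (auto simp: eventually_at_bot_linorder)
    moreover have "eventually (\<lambda>z. F z > x) at_top" using top by (simp add: filterlim_at_top_dense)
    then obtain z1 where "F z1 > x" by (auto simp: eventually_at_top_linorder)
    ultimately have "F z0 \<le> x" "x \<le> F z1" "z0 \<le> z1"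
      using less_iff[of z0 z1] by auto
    then show ?thesis using IVT[of F z0 x z1] cont by blast
  qed
  define Z where "Z = inv F"
  have ZF: "Z (F z) = z" for z using inj by (simp add: Z_def)
  have FZ: "F (Z x) = x" if "x > 0" for x using onto[OF that] ZF by metis
  show thesis
  proof
    show "bij_betw Z {0<..} UNIV"
      by (rule bij_betw_byWitness[where f' = F]) (use FZ ZF pos in auto)
    show "(Z has_real_derivative inverse (h (Z x))) (at x)" if x: "x > 0" for x
    proof (rule DERIV_inverse_function[where f = F and a = 0 and b = "x + 1"])
      have "isCont Z (F (Z x))"
        by (rule isCont_inverse_function2[of "Z x - 1" "Z x" "Z x + 1"]) (use ZF cont in auto)
      then show "isCont Z x" using FZ x by simp
      show "h (Z x) \<noteq> 0" using h[of "Z x"] by simp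
    qed (use F FZ x in auto)
    show "filterlim Z at_top at_top"
      unfolding filterlim_at_top
    proof
      fix K
      have "K \<le> Z x" if "x \<ge> F K" for x
        using that pos[of K] FZ[of x] le_iff[of K "Z x"] by simp
      then show "eventually (\<lambda>x. K \<le> Z x) at_top" by (auto simp: eventually_at_top_linorder)
    qed
    show "filterlim Z at_bot (at_right 0)"
      unfolding filterlim_at_bot
    proof
      fix K
      have "Z x \<le> K" if "0 < x" "x < F K" for x
        using that FZ[of x] le_iff[of "Z x" K] by simp
      then show "eventually (\<lambda>x. Z x \<le> K) (at_right 0)"
        using pos[of K] eventually_at_right_field by blast
    qed
  qed (use ZF FZ pos in auto)
qed

text \<open>In the variable \<open>\<sigma> = e\<^bsup>lmz\<^esup>\<close> the integral of \<open>\<Phi>\<^sup>m dz\<close> has a continuous integrand down to \<open>\<sigma> = 0\<close>,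
  which is why \<open>z = -\<infinity>\<close> corresponds to a finite \<open>\<xi>\<close>.\<close>
lemma wave_coordinate_exists:
  assumes l: "l > 0" and m: "m > 0" and a: "a > 0"
    and y: "continuous_on UNIV y" "y 0 = 1"
    and \<Phi>: "\<And>z. \<Phi> z = exp (l * z) * y (exp (l * z))" "\<And>z. 0 < \<Phi> z" "(\<Phi> \<longlongrightarrow> a) at_top"
  obtains F :: "real \<Rightarrow> real" where "\<And>z. (F has_real_derivative \<Phi> z powr m) (at z)"
    "(F \<longlongrightarrow> 0) at_bot" "filterlim F at_top at_top"
proof -
  have ypos: "y s > 0" if "s \<ge> 0" for s
  proof (cases "s = 0")
    case False
    then have "exp (l * (ln s / l)) = s" using that l by simp
    with \<Phi>(1)[of "ln s / l"] \<Phi>(2)[of "ln s / l"] show ?thesis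
      using that False by (simp add: zero_less_mult_iff)
  qed (use y in simp)
  \<comment> \<open>With \<open>\<rho> = exp (l * m * z)\<close>, the form
    \<open>\<Phi> z powr m\<close> dz becomes \<open>h \<rho> / (l * m)\<close> d\<rho>, as the
    factor \<open>\<rho>\<close> cancels.\<close>
  define h where "h \<rho> = y (\<rho> powr (1 / m)) powr m" for \<rho>
  have h: "continuous_on {0..b} h" for b
    unfolding h_def[abs_def] using m
    by (intro continuous_on_powr continuous_on_compose2[OF y(1)] continuous_on_powr' continuous_intros)
      (use ypos[OF powr_ge_zero] in \<open>auto simp: less_le\<close>)
  define X where "X \<sigma> = 1 / (l * m) * integral {0..\<sigma>} h" for \<sigma>
  have X': "(X has_real_derivative 1 / (l * m) * h \<sigma>) (at \<sigma>)" if "\<sigma> > 0" for \<sigma>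
    using DERIV_cmult[OF integral_has_real_derivative[OF h, of \<sigma> "\<sigma> + 1"], of "1 / (l * m)"] that
    by (simp add: X_def[abs_def] at_within_Icc_at)
  have lm: "l * m > 0" using l m by simp
  define F where "F z = X (exp (l * m * z))" for z
  have F: "(F has_real_derivative \<Phi> z powr m) (at z)" for z
  proof -
    have "(F has_real_derivative 1 / (l * m) * h (exp (l * m * z)) * (l * m * exp (l * m * z))) (at z)"
      unfolding F_def[abs_def]
      by (rule DERIV_chain2[OF X']) (auto intro!: derivative_eq_intros)
    also have "1 / (l * m) * h (exp (l * m * z)) * (l * m * exp (l * m * z)) = h (exp (l * m * z)) * exp (l * m * z)"
      using l m by (simp add: field_simps)
    also have "h (exp (l * m * z)) = y (exp (l * z)) powr m"
      using m by (simp add: h_def exp_powr_real)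
    also have "exp (l * m * z) = exp (l * z) powr m" by (simp add: exp_powr_real mult_ac)
    also have "y (exp (l * z)) powr m * exp (l * z) powr m = \<Phi> z powr m"
      using ypos[of "exp (l * z)"] by (simp add: \<Phi>(1) powr_mult mult.commute)
    finally show ?thesis .
  qed
  have bot: "(F \<longlongrightarrow> 0) at_bot"
  proof -
    have e0: "((\<lambda>z. exp (l * m * z)) \<longlongrightarrow> 0) at_bot" using lm by (rule tendsto_exp_mult_at_bot)
    have "continuous_on {0..1} X"
      unfolding X_def[abs_def] using h[of 1]
      by (intro continuous_intros indefinite_integral_continuous_1 integrable_continuous_interval)
    moreover have "eventually (\<lambda>z. exp (l * m * z) \<in> {0..1}) at_bot"
      using order_tendstoD(2)[OF e0, of 1] by (auto elim: eventually_mono)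
    ultimately have "(F \<longlongrightarrow> X 0) at_bot"
      unfolding F_def[abs_def] by (intro continuous_on_tendsto_compose[OF _ e0]) auto
    then show ?thesis by (simp add: X_def)
  qed
  have top: "filterlim F at_top at_top"
  proof -
    \<comment> \<open>Eventually \<open>\<Phi>\<close> exceeds \<open>a / 2\<close>, so
      \<open>F\<close> grows at least linearly with this slope.\<close>
    define \<epsilon> where "\<epsilon> = (a / 2) powr m"
    have \<epsilon>: "\<epsilon> > 0" using a by (simp add: \<epsilon>_def)
    have "eventually (\<lambda>z. \<Phi> z > a / 2) at_top" by (rule order_tendstoD(1)[OF \<Phi>(3)]) (use a in simp)
    then obtain N where N: "\<And>z. z \<ge> N \<Longrightarrow> \<Phi> z > a / 2" by (auto simp: eventually_at_top_linorder)
    have ge: "F N - \<epsilon> * N + \<epsilon> * z \<le> F z" if "z \<ge> N" for z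
    proof -
      have "F N - \<epsilon> * N \<le> F z - \<epsilon> * z"
      proof (rule DERIV_nonneg_imp_nondecreasing[OF that])
        fix x assume "N \<le> x" "x \<le> z"
        then have "\<epsilon> \<le> \<Phi> x powr m"
          unfolding \<epsilon>_def using N[of x] a m by (intro powr_mono2) auto
        moreover have "((\<lambda>z. F z - \<epsilon> * z) has_real_derivative \<Phi> x powr m - \<epsilon>) (at x)"
          by (auto intro!: derivative_eq_intros F)
        ultimately show "\<exists>y. ((\<lambda>z. F z - \<epsilon> * z) has_real_derivative y) (at x) \<and> 0 \<le> y" by fastforce
      qed
      then show ?thesis by simp
    qed
    have "filterlim (\<lambda>z. \<epsilon> * z) at_top at_top"
      using \<epsilon> by (simp add: filterlim_tendsto_pos_mult_at_top[OF tendsto_const] filterlim_ident)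
    then have "filterlim (\<lambda>z. F N - \<epsilon> * N + \<epsilon> * z) at_top at_top"
      by (rule filterlim_tendsto_add_at_top[OF tendsto_const])
    then show ?thesis
      by (rule filterlim_at_top_mono) (use ge in \<open>auto simp: eventually_at_top_linorder\<close>)
  qed
  show thesis using that F bot top by blast
qed

text \<open>The reaction exponent \<open>1 - m\<close> is what makes \<open>u powr m\<close> times
  the reaction the cubic of the orbit equation. The front is placed at 0.\<close>

lemma bistable_finite_travelling_wave:
  assumes a: "0 < a" "a < 1/2" and c: "0 < c" "c\<^sup>2 < 4 * a * (1 - a)" and m: "0 < m" "m < 1"
  shows "\<exists>\<xi>min \<phi>v \<phi> \<Phi> \<Psi>.
           \<phi> = (\<lambda>\<xi>. if \<xi> > \<xi>min then \<phi>v \<xi> else 0) \<and>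
           finite_travelling_wave m (reaction (1 - m) a) c \<phi> \<and>
           tends_with_oscillation \<phi> a \<and>
           connecting_orbit a c \<Phi> \<Psi> \<and>
           desingularized_by m \<xi>min \<phi>v \<Phi>"
proof -
  obtain l y \<Phi> \<Psi> where l: "l > 0" and y: "continuous_on UNIV y" "y 0 = 1"
    and \<Phi>_eq: "\<And>z. \<Phi> z = exp (l * z) * y (exp (l * z))"
    and \<Phi>0: "\<And>z. 0 < \<Phi> z" and \<Phi>1: "\<And>z. \<Phi> z < 1"
    and \<Psi>_lim: "((\<lambda>z. \<Psi> z / exp (l * z)) \<longlongrightarrow> l) at_bot"
    and orbit: "connecting_orbit a c \<Phi> \<Psi>"
    and osc: "\<And>Z. \<exists>z>Z. \<Phi> z < a" "\<And>Z. \<exists>z>Z. \<Phi> z > a"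
    using connecting_orbit_exists[OF a c] by blast
  have \<Phi>: "(\<Phi> has_real_derivative \<Psi> z) (at z)"
    and \<Psi>: "(\<Psi> has_real_derivative (- c * \<Psi> z - \<Phi> z * (1 - \<Phi> z) * (\<Phi> z - a))) (at z)" for z
    using orbit by (auto simp: connecting_orbit_def)
  have \<Phi>_bot: "(\<Phi> \<longlongrightarrow> 0) at_bot" and \<Psi>_bot: "(\<Psi> \<longlongrightarrow> 0) at_bot" and \<Phi>_top: "(\<Phi> \<longlongrightarrow> a) at_top"
    using orbit by (auto simp: connecting_orbit_def dest: tendsto_fst tendsto_snd)
  obtain F where F: "\<And>z. (F has_real_derivative \<Phi> z powr m) (at z)"
    "(F \<longlongrightarrow> 0) at_bot" "filterlim F at_top at_top"
    using wave_coordinate_exists[OF l m(1) a(1) y \<Phi>_eq \<Phi>0 \<Phi>_top] by blast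
  have "\<Phi> z powr m > 0" for z using \<Phi>0[of z] by simp
  then obtain Z where Z: "bij_betw Z {0<..} UNIV" "\<And>x. x > 0 \<Longrightarrow> F (Z x) = x" "\<And>z. Z (F z) = z" "\<And>z. F z > 0"
    and Z'_inv: "\<And>x. x > 0 \<Longrightarrow> (Z has_real_derivative inverse (\<Phi> (Z x) powr m)) (at x)"
    and Z_top: "filterlim Z at_top at_top" and Z_0: "filterlim Z at_bot (at_right 0)"
    using inverse_of_increasing_onto_positive[OF F(1) _ F(2,3)] by blast
  have Z': "(Z has_real_derivative \<Phi> (Z x) powr (- m)) (at x)" if "x > 0" for x
    using Z'_inv[OF that] by (simp add: powr_minus)
  note \<Phi>Z = DERIV_chain2[OF \<Phi> Z'] and \<Psi>Z = DERIV_chain2[OF \<Psi> Z']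
  \<comment> \<open>Profile, its derivative, and its flux: in the physical variable the derivative
    is \<open>\<Psi> * \<Phi> powr (- m)\<close>, and multiplication by \<open>\<Phi> powr m\<close>
    leaves \<open>\<Psi>\<close>.\<close>
  define v where "v x = (if x > 0 then \<Phi> (Z x) else 0)" for x
  define v' where "v' x = (if x > 0 then \<Psi> (Z x) * \<Phi> (Z x) powr (- m) else 0)" for x
  define w' where "w' x = (if x > 0 then \<Psi> (Z x) else 0)" for x
  let ?f = "reaction (1 - m) a"
  \<comment> \<open>Near the saddle \<open>\<Psi>\<close> is asymptotic to
    \<open>l * \<Phi>\<close>, so this is of order \<open>\<Phi> powr (1 - m)\<close> and vanishes
    in the limit because \<open>m < 1\<close>.\<close>
  have speed_bot: "((\<lambda>z. \<Psi> z * \<Phi> z powr (- m)) \<longlongrightarrow> 0) at_bot"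
  proof -
    have "((\<lambda>z. y (exp (l * z))) \<longlongrightarrow> 1) at_bot"
      using isCont_tendsto_compose[OF _ tendsto_exp_mult_at_bot[OF l], of y] y by (simp add: continuous_on_eq_continuous_at)
    moreover have "((\<lambda>z. \<Phi> z powr (1 - m)) \<longlongrightarrow> 0 powr (1 - m)) at_bot"
      using m \<Phi>0 by (intro tendsto_powr2 \<Phi>_bot tendsto_const) (auto intro: always_eventually less_imp_le)
    ultimately have "((\<lambda>z. \<Psi> z / exp (l * z) / y (exp (l * z)) * \<Phi> z powr (1 - m)) \<longlongrightarrow> l / 1 * 0 powr (1 - m)) at_bot"
      by (intro tendsto_mult tendsto_divide \<Psi>_lim) auto
    moreover have "\<Psi> z / exp (l * z) / y (exp (l * z)) * \<Phi> z powr (1 - m) = \<Psi> z * \<Phi> z powr (- m)" for z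
    proof -
      have "y (exp (l * z)) \<noteq> 0" using \<Phi>0[of z] by (auto simp: \<Phi>_eq)
      then have "\<Psi> z / exp (l * z) / y (exp (l * z)) * \<Phi> z = \<Psi> z" by (simp add: \<Phi>_eq)
      moreover have "\<Phi> z powr (1 - m) = \<Phi> z * \<Phi> z powr (- m)"
        using \<Phi>0[of z] by (simp add: powr_diff powr_minus divide_inverse)
      ultimately show ?thesis by (metis mult.assoc)
    qed
    ultimately show ?thesis by simp
  qed
  have v: "(v has_real_derivative v' x) (at x)" for x
    unfolding v_def[abs_def] v'_def
    by (rule has_real_derivative_extend_by_0)
      (auto intro: \<Phi>Z filterlim_compose[OF _ Z_0] \<Phi>_bot speed_bot)
  have cont_speed: "continuous_on {0<..} (\<lambda>x. \<Psi> (Z x) * \<Phi> (Z x) powr (- m))"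
  proof (rule continuous_at_imp_continuous_on, rule ballI)
    fix x :: real assume x: "x \<in> {0<..}"
    then have "isCont (\<lambda>x. \<Psi> (Z x)) x" "isCont (\<lambda>x. \<Phi> (Z x)) x"
      using DERIV_isCont[OF \<Psi>Z] DERIV_isCont[OF \<Phi>Z] by auto
    then show "isCont (\<lambda>x. \<Psi> (Z x) * \<Phi> (Z x) powr (- m)) x"
      using \<Phi>0[of "Z x"] by (intro continuous_intros) auto
  qed
  have cont_v': "continuous_on UNIV v'"
    unfolding v'_def[abs_def]
    by (rule continuous_on_extend_by_0[OF cont_speed filterlim_compose[OF speed_bot Z_0]])
  have cont_v: "continuous_on UNIV v" using v by (meson DERIV_continuous_on has_field_derivative_at_within)
  have v01: "0 \<le> v x" "v x \<le> 1" for x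
    using \<Phi>0[of "Z x"] \<Phi>1[of "Z x"] by (auto simp: v_def)
  have f_cont: "continuous_on UNIV (\<lambda>x. ?f (v x))"
    unfolding reaction_def using m v01 cont_v
    by (intro continuous_intros continuous_on_powr') auto
  have reaction_powr: "?f (\<Phi> z) = \<Phi> z * (1 - \<Phi> z) * (\<Phi> z - a) * \<Phi> z powr (- m)" for z
    using \<Phi>0[of z] by (simp add: reaction_def powr_diff powr_minus field_simps)
  have f_bot: "((\<lambda>z. ?f (\<Phi> z)) \<longlongrightarrow> 0) at_bot"
  proof -
    have "((\<lambda>z. ?f (\<Phi> z)) \<longlongrightarrow> 0 powr (1 - m) * (1 - 0) * (0 - a)) at_bot"
      unfolding reaction_def using m \<Phi>0
      by (intro tendsto_intros tendsto_powr2 \<Phi>_bot) (auto intro: always_eventually less_imp_le)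
    then show ?thesis by simp
  qed
  have w: "((\<lambda>x. v x powr (m + 1)) has_real_derivative (m + 1) * w' x) (at x)" for x
  proof -
    have "((\<lambda>x. \<Phi> (Z x) powr (m + 1)) has_real_derivative (m + 1) * \<Psi> (Z x)) (at x)" if x: "x > 0" for x
    proof -
      have "((\<lambda>x. \<Phi> (Z x) powr (m + 1)) has_real_derivative
          (m + 1) * \<Phi> (Z x) powr (m + 1 - 1) * (\<Psi> (Z x) * \<Phi> (Z x) powr (- m))) (at x)"
        by (rule DERIV_chain2[OF has_real_derivative_powr[OF \<Phi>0] \<Phi>Z[OF x]])
      also have "(m + 1) * \<Phi> (Z x) powr (m + 1 - 1) * (\<Psi> (Z x) * \<Phi> (Z x) powr (- m)) = (m + 1) * \<Psi> (Z x)"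
        using \<Phi>0[of "Z x"] by (simp add: powr_minus)
      finally show ?thesis .
    qed
    moreover have "((\<lambda>z. \<Phi> z powr (m + 1)) \<longlongrightarrow> 0 powr (m + 1)) at_bot"
      using m \<Phi>0 by (intro tendsto_powr2 \<Phi>_bot tendsto_const) (auto intro: always_eventually less_imp_le)
    then have "((\<lambda>x. \<Phi> (Z x) powr (m + 1)) \<longlongrightarrow> 0) (at_right 0)"
      using filterlim_compose[OF _ Z_0] by force
    moreover have "((\<lambda>x. (m + 1) * \<Psi> (Z x)) \<longlongrightarrow> 0) (at_right 0)"
      by (intro tendsto_mult_right_zero filterlim_compose[OF \<Psi>_bot Z_0])
    ultimately have "((\<lambda>x. if x > 0 then \<Phi> (Z x) powr (m + 1) else 0) has_real_derivative
        (if x > 0 then (m + 1) * \<Psi> (Z x) else 0)) (at x)"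
      by (rule has_real_derivative_extend_by_0)
    \<comment> \<open>The zero extension is consistent because
      \<open>0 powr (m + 1) = 0\<close>.\<close>
    moreover have "(\<lambda>x. v x powr (m + 1)) = (\<lambda>x. if x > 0 then \<Phi> (Z x) powr (m + 1) else 0)"
      by (simp add: fun_eq_iff v_def)
    moreover have "(m + 1) * w' x = (if x > 0 then (m + 1) * \<Psi> (Z x) else 0)" by (simp add: w'_def)
    ultimately show ?thesis by (simp only:)
  qed
  \<comment> \<open>The wave equation holds at the front as well: slope and reaction both vanish
    there, and the one-sided limits agree with this.\<close>
  have w': "(w' has_real_derivative (- c * v' x - ?f (v x))) (at x)" for x
  proof -
    have "(w' has_real_derivative (if x > 0 then - c * (\<Psi> (Z x) * \<Phi> (Z x) powr (- m)) - ?f (\<Phi> (Z x)) else 0)) (at x)"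
      unfolding w'_def[abs_def]
    proof (rule has_real_derivative_extend_by_0)
      fix x :: real assume "x > 0"
      from \<Psi>Z[OF this]
      show "((\<lambda>x. \<Psi> (Z x)) has_real_derivative - c * (\<Psi> (Z x) * \<Phi> (Z x) powr (- m)) - ?f (\<Phi> (Z x))) (at x)"
        unfolding reaction_powr by (simp add: algebra_simps)
    next
      show "((\<lambda>x. \<Psi> (Z x)) \<longlongrightarrow> 0) (at_right 0)" by (rule filterlim_compose[OF \<Psi>_bot Z_0])
      have "((\<lambda>z. - c * (\<Psi> z * \<Phi> z powr (- m)) - ?f (\<Phi> z)) \<longlongrightarrow> - c * 0 - 0) at_bot"
        by (intro tendsto_intros speed_bot f_bot)
      then show "((\<lambda>x. - c * (\<Psi> (Z x) * \<Phi> (Z x) powr (- m)) - ?f (\<Phi> (Z x))) \<longlongrightarrow> 0) (at_right 0)"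
        using filterlim_compose[OF _ Z_0] by force
    qed
    moreover have "(if x > 0 then - c * (\<Psi> (Z x) * \<Phi> (Z x) powr (- m)) - ?f (\<Phi> (Z x)) else 0) = - c * v' x - ?f (v x)"
      by (simp add: v_def v'_def reaction_def)
    ultimately show ?thesis by (simp only:)
  qed
  have weak: "weak_solution m ?f v (\<lambda>t x. v (x - c * t))"
    unfolding weak_solution_def
  proof (intro conjI allI impI)
    show "continuous_on UNIV v" by (rule cont_v)
    show "0 \<le> v x" "v x \<le> 1" "0 \<le> v (x - c * t)" for x t by (rule v01)+
    fix r T :: real assume r: "r > 0" and T: "T > 0"
    show cont: "continuous_on (QT T) (\<lambda>(t, x). v (x - c * t))"
      unfolding split_beta by (intro continuous_on_compose2[OF cont_v] continuous_intros) auto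
    show "Linfty_on (QT T) (\<lambda>t x. v (x - c * t))"
      unfolding Linfty_on_def
    proof
      have "open (QT T)" unfolding QT_def by (intro open_Times) auto
      then have "QT T \<in> sets lebesgue" by simp
      then show "(\<lambda>(t, x). v (x - c * t)) \<in> borel_measurable (lebesgue_on (QT T))"
        by (rule continuous_imp_measurable_on_sets_lebesgue[OF cont])
      have "AE q in lebesgue_on (QT T). \<bar>case q of (t, x) \<Rightarrow> v (x - c * t)\<bar> \<le> 1"
        by (intro AE_I2) (simp add: split_beta v01)
      then show "\<exists>C. AE q in lebesgue_on (QT T). \<bar>case q of (t, x) \<Rightarrow> v (x - c * t)\<bar> \<le> C" ..
    qed
    fix \<phi> \<phi>t \<phi>x \<phi>xx
    assume "C21_strip T \<phi> \<phi>t \<phi>x \<phi>xx" "\<forall>t\<in>{0..T}. \<phi> t r = 0 \<and> \<phi> t (- r) = 0"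
    then show "weak_identity m ?f v (\<lambda>t x. v (x - c * t)) r T \<phi> \<phi>t \<phi>x \<phi>xx"
      using m by (intro travelling_wave_weak_identity[OF _ v cont_v' w w' f_cont r T]) auto
  qed
  have v_F: "v (F z) = \<Phi> z" for z using Z by (simp add: v_def)
  \<comment> \<open>Every value of \<open>\<Phi>\<close> at a late \<open>z\<close> is the value of
    \<open>v\<close> at the late position \<open>F z\<close>, so the oscillation survives the change
    of variable.\<close>
  have v_far: "\<exists>x>X. P (v x)" if P: "\<And>N. \<exists>z>N. P (\<Phi> z)" for P X
  proof -
    have "eventually (\<lambda>z. F z > X) at_top" using F(3) by (simp add: filterlim_at_top_dense)
    then obtain N where N: "\<And>z. z \<ge> N \<Longrightarrow> F z > X" by (auto simp: eventually_at_top_linorder)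
    obtain z where "z > N" "P (\<Phi> z)" using P by blast
    then show ?thesis using N[of z] by (intro exI[of _ "F z"]) (simp add: v_F)
  qed
  have "tends_with_oscillation v a"
    unfolding tends_with_oscillation_def
  proof
    show "(v \<longlongrightarrow> a) at_top"
      by (rule Lim_transform_eventually[OF filterlim_compose[OF \<Phi>_top Z_top]])
        (auto simp: v_def eventually_at_top_dense)
    show "changes_sign_infinitely_often (\<lambda>\<xi>. v \<xi> - a)"
      by (rule changes_sign_infinitely_oftenI) (use v_far[of "\<lambda>u. u < a"] v_far[of "\<lambda>u. u > a"] osc in simp_all)
  qed
  moreover have "finite_travelling_wave m ?f c v"
    unfolding finite_travelling_wave_def using weak by (auto simp: v_def intro!: exI[of _ 0])
  moreover have "desingularized_by m 0 (\<lambda>x. \<Phi> (Z x)) \<Phi>"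
    unfolding desingularized_by_def using \<Phi>0 Z(1) Z' by blast
  moreover have "v = (\<lambda>x. if x > 0 then \<Phi> (Z x) else 0)" by (simp add: v_def[abs_def])
  ultimately show ?thesis
    using orbit by (intro exI[of _ 0] exI[of _ "\<lambda>x. \<Phi> (Z x)"] exI[of _ v] exI[of _ \<Phi>] exI[of _ \<Psi>] conjI)
qed

theorem mainTheorem6:
  fixes m p a :: real
  assumes "m = 3 / 4" and "p = 1 / 4" and "a = 3 / 10"
  shows "\<forall>c\<in>{999 / 10000 .. 1001 / 10000}. \<exists>\<xi>min \<phi>v \<phi> \<Phi> \<Psi>.
           \<phi> = (\<lambda>\<xi>. if \<xi> > \<xi>min then \<phi>v \<xi> else 0) \<and>
           finite_travelling_wave m (reaction p a) c \<phi> \<and>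
           tends_with_oscillation \<phi> a \<and>
           connecting_orbit a c \<Phi> \<Psi> \<and>
           desingularized_by m \<xi>min \<phi>v \<Phi>"
proof
  fix c :: real assume c: "c \<in> {999 / 10000 .. 1001 / 10000}"
  have a: "0 < a" "a < 1/2" and m: "0 < m" "m < 1" and p: "p = 1 - m" and "c > 0"
    using assms c by simp_all
  \<comment> \<open>The spiral condition holds with a wide margin: about 0.01 against 0.84.\<close>
  have "c\<^sup>2 \<le> (1001 / 10000)\<^sup>2" using c by (intro power_mono) auto
  also have "\<dots> < 4 * a * (1 - a)" by (simp add: assms power2_eq_square)
  finally show "\<exists>\<xi>min \<phi>v \<phi> \<Phi> \<Psi>.
           \<phi> = (\<lambda>\<xi>. if \<xi> > \<xi>min then \<phi>v \<xi> else 0) \<and>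
           finite_travelling_wave m (reaction p a) c \<phi> \<and>
           tends_with_oscillation \<phi> a \<and>
           connecting_orbit a c \<Phi> \<Psi> \<and>
           desingularized_by m \<xi>min \<phi>v \<Phi>"
    unfolding p by (rule bistable_finite_travelling_wave[OF a \<open>c > 0\<close> _ m])
qed

end
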